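(* The fundamental $2$-form $\Omega$ on $\mathcal{A}$, given for $J\in\mathcal{A}$ and $A,B\in T_J\mathcal{A}$ by $$\Omega_J(A,B)=\int_M \mathrm{tr}(A\,J\,B)\,d\mu(g_0),$$ is closed: $d\Omega=0$.
   Context: $M$ is a smooth closed oriented manifold of dimension $2n$, and $g_0$ is a fixed Riemannian metric on $M$ with Riemannian volume element $\mu(g_0)$. $\mathcal{A}$ is the space of all smooth almost complex structures on $M$, i.e. smooth endomorphism fields $J:TM\to TM$ with $J^2=-\mathrm{Id}$; it is an infinite-dimensional smooth ILH-manifold (inverse limit of Hilbert manifolds), being the space of smooth sections of a bundle over $M$. For $J\in\mathcal{A}$, $T_J\mathcal{A}=\mathrm{End}_J(TM)$ is the space of smooth endomorphisms $K:TM\to TM$ with $JK+KJ=0$. Local charts: for $J_0\in\mathcal{A}$ let $\mathcal{U}(J_0)=\{J\in\mathcal{A}: 1-JJ_0 \text{ is an isomorphism of } TM\}$ and $\mathcal{V}(J_0)=\{K\in\mathrm{End}_{J_0}(TM): 1-K\text{ is invertible}\}$; the chart is $\Phi:\mathcal{U}(J_0)\to\mathcal{V}(J_0)$, $\Phi(J)=(1-JJ_0)^{-1}(1+JJ_0)$, with inverse $K\mapsto J_K=J_0(1+K)(1-K)^{-1}$. On $\mathcal{A}$ one has the weak pseudo-Riemannian structure $(A,B)_J=\int_M\mathrm{tr}(A\circ B)\,d\mu(g_0)$ and the almost complex structure $\mathbf{J}_J(A)=A\circ J$, and $\Omega_J(A,B)=(\mathbf{J}_JA,B)_J$ is the fundamental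 form of this Hermitian weak pseudo-Riemannian structure. *)

theory Defs
  imports "HOL-Analysis.Analysis"
begin

section \<open>Smooth maps between open subsets of normed spaces\<close>

text \<open>Only meant for open \<open>S\<close> in a finite-dimensional space, where asking for all iterated
  directional derivatives to exist and be differentiable is the usual notion.\<close>

primrec Ck_on :: "nat \<Rightarrow> 'a::real_normed_vector set \<Rightarrow> ('a \<Rightarrow> 'b::real_normed_vector) \<Rightarrow> bool" where
  "Ck_on 0 S f \<longleftrightarrow> continuous_on S f"
| "Ck_on (Suc k) S f \<longleftrightarrow> (\<forall>x\<in>S. f differentiable (at x)) \<and>
     (\<forall>v. Ck_on k S (\<lambda>x. frechet_derivative f (at x) v))"

definition smooth_on :: "'a::real_normed_vector set \<Rightarrow> ('a \<Rightarrow> 'b::real_normed_vector) \<Rightarrow> bool" where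
  "smooth_on S f \<longleftrightarrow> (\<forall>k. Ck_on k S f)"


section \<open>Closed oriented manifolds\<close>

text \<open>A chart is a pair \<open>(U, \<phi>)\<close>; the values of \<open>\<phi>\<close> outside \<open>U\<close> are irrelevant.  The manifold is
  the whole type \<open>'m\<close>, its dimension is \<open>CARD('d)\<close>.\<close>

type_synonym ('m, 'd) chart = "'m set \<times> ('m \<Rightarrow> real^'d)"

abbreviation chart_dom :: "('m, 'd) chart \<Rightarrow> 'm set" where
  "chart_dom c \<equiv> fst c"

abbreviation chart_im :: "('m, 'd) chart \<Rightarrow> (real^'d) set" where
  "chart_im c \<equiv> snd c ` fst c"

abbreviation chart_inv :: "('m, 'd) chart \<Rightarrow> real^'d \<Rightarrow> 'm" where
  "chart_inv c \<equiv> inv_into (fst c) (snd c)"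

definition is_chart :: "('m::topological_space, 'd::finite) chart \<Rightarrow> bool" where
  "is_chart c \<longleftrightarrow> open (chart_dom c) \<and> open (chart_im c) \<and>
     homeomorphism (chart_dom c) (chart_im c) (snd c) (chart_inv c)"

definition transition :: "('m, 'd::finite) chart \<Rightarrow> ('m, 'd) chart \<Rightarrow> real^'d \<Rightarrow> real^'d" where
  "transition c d = snd d \<circ> chart_inv c"

definition transition_deriv ::
    "('m, 'd::finite) chart \<Rightarrow> ('m, 'd) chart \<Rightarrow> 'm \<Rightarrow> real^'d \<Rightarrow> real^'d" where
  "transition_deriv c d p = frechet_derivative (transition c d) (at (snd c p))"

text \<open>Smooth structure and orientation are both given by an atlas, not necessarily maximal, whose
  transition maps are smooth and orientation preserving.  The charts take values in open subsets
  of Euclidean space, so there is no boundary.\<close>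

definition closed_oriented_manifold ::
    "('m::{t2_space, second_countable_topology}, 'd::finite) chart set \<Rightarrow> bool" where
  "closed_oriented_manifold atlas \<longleftrightarrow>
     compact (UNIV :: 'm set) \<and>
     (\<Union>c\<in>atlas. chart_dom c) = UNIV \<and>
     (\<forall>c\<in>atlas. is_chart c) \<and>
     (\<forall>c\<in>atlas. \<forall>d\<in>atlas. smooth_on (snd c ` (chart_dom c \<inter> chart_dom d)) (transition c d)) \<and>
     (\<forall>c\<in>atlas. \<forall>d\<in>atlas. \<forall>p\<in>chart_dom c \<inter> chart_dom d.
        det (matrix (transition_deriv c d p)) > 0)"


section \<open>Tangent spaces, endomorphism fields, Riemannian metrics\<close>

text \<open>A tangent vector at \<open>p\<close> assigns to each chart around \<open>p\<close> a coordinate vector, subject to the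
  transformation law under change of charts; it is set to \<open>0\<close> on everything that is not a chart
  around \<open>p\<close>, so that equality of functions is equality of tangent vectors.  The vector space
  structure is the pointwise one.\<close>

type_synonym ('m, 'd) tvec = "('m, 'd) chart \<Rightarrow> real^'d"

definition lincomb :: "real \<Rightarrow> ('m, 'd::finite) tvec \<Rightarrow> real \<Rightarrow> ('m, 'd) tvec \<Rightarrow> ('m, 'd) tvec" where
  "lincomb r v s w = (\<lambda>c. r *\<^sub>R v c + s *\<^sub>R w c)"

definition tangent_space :: "('m, 'd::finite) chart set \<Rightarrow> 'm \<Rightarrow> ('m, 'd) tvec set" where
  "tangent_space atlas p = {v.
     (\<forall>c\<in>atlas. \<forall>d\<in>atlas. p \<in> chart_dom c \<inter> chart_dom d \<longrightarrow> v d = transition_deriv c d p (v c)) \<and>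
     (\<forall>c. c \<notin> atlas \<or> p \<notin> chart_dom c \<longrightarrow> v c = 0)}"

text \<open>The tangent vector at \<open>p\<close> whose coordinate vector in the chart \<open>c\<close> is \<open>x\<close>.\<close>

definition tvec_of :: "('m, 'd::finite) chart set \<Rightarrow> ('m, 'd) chart \<Rightarrow> 'm \<Rightarrow> real^'d \<Rightarrow> ('m, 'd) tvec" where
  "tvec_of atlas c p x =
     (\<lambda>d. if d \<in> atlas \<and> p \<in> chart_dom d then transition_deriv c d p x else 0)"

type_synonym ('m, 'd) endo = "('m, 'd) tvec \<Rightarrow> ('m, 'd) tvec"

definition is_endo :: "('m, 'd::finite) chart set \<Rightarrow> 'm \<Rightarrow> ('m, 'd) endo \<Rightarrow> bool" where
  "is_endo atlas p L \<longleftrightarrow>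
     (\<forall>v\<in>tangent_space atlas p. L v \<in> tangent_space atlas p) \<and>
     (\<forall>v\<in>tangent_space atlas p. \<forall>w\<in>tangent_space atlas p. \<forall>r s.
        L (lincomb r v s w) = lincomb r (L v) s (L w))"

definition endo_matrix ::
    "('m, 'd::finite) chart set \<Rightarrow> ('m, 'd) chart \<Rightarrow> 'm \<Rightarrow> ('m, 'd) endo \<Rightarrow> real^'d^'d" where
  "endo_matrix atlas c p L = matrix (\<lambda>x. L (tvec_of atlas c p x) c)"

text \<open>The value does not depend on the chart around \<open>p\<close> that is chosen.\<close>

definition endo_trace :: "('m, 'd::finite) chart set \<Rightarrow> 'm \<Rightarrow> ('m, 'd) endo \<Rightarrow> real" where
  "endo_trace atlas p L = trace (endo_matrix atlas (SOME c. c \<in> atlas \<and> p \<in> chart_dom c) p L)"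

text \<open>An endomorphism field maps \<open>p\<close> to an endomorphism of the tangent space at \<open>p\<close>; the values
  on functions that are not tangent vectors at \<open>p\<close> are unconstrained and never used.\<close>

type_synonym ('m, 'd) endo_field = "'m \<Rightarrow> ('m, 'd) endo"

definition smooth_endo_field :: "('m, 'd::finite) chart set \<Rightarrow> ('m, 'd) endo_field \<Rightarrow> bool" where
  "smooth_endo_field atlas K \<longleftrightarrow>
     (\<forall>p. is_endo atlas p (K p)) \<and>
     (\<forall>c\<in>atlas. smooth_on (chart_im c)
        (\<lambda>x. endo_matrix atlas c (chart_inv c x) (K (chart_inv c x))))"

definition gram_matrix ::
    "('m, 'd::finite) chart set \<Rightarrow> ('m \<Rightarrow> ('m, 'd) tvec \<Rightarrow> ('m, 'd) tvec \<Rightarrow> real) \<Rightarrow>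
     ('m, 'd) chart \<Rightarrow> 'm \<Rightarrow> real^'d^'d" where
  "gram_matrix atlas g c p =
     (\<chi> i j. g p (tvec_of atlas c p (axis i 1)) (tvec_of atlas c p (axis j 1)))"

definition riemannian_metric ::
    "('m, 'd::finite) chart set \<Rightarrow> ('m \<Rightarrow> ('m, 'd) tvec \<Rightarrow> ('m, 'd) tvec \<Rightarrow> real) \<Rightarrow> bool" where
  "riemannian_metric atlas g \<longleftrightarrow>
     (\<forall>p. \<forall>u\<in>tangent_space atlas p. \<forall>v\<in>tangent_space atlas p. \<forall>w\<in>tangent_space atlas p. \<forall>r s.
        g p (lincomb r u s v) w = r * g p u w + s * g p v w) \<and>
     (\<forall>p. \<forall>u\<in>tangent_space atlas p. \<forall>v\<in>tangent_space atlas p. g p u v = g p v u) \<and>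
     (\<forall>p. \<forall>u\<in>tangent_space atlas p. u \<noteq> (\<lambda>_. 0) \<longrightarrow> g p u u > 0) \<and>
     (\<forall>c\<in>atlas. smooth_on (chart_im c) (\<lambda>x. gram_matrix atlas g c (chart_inv c x)))"

text \<open>The Riemannian volume is the unique Borel measure that is given in every chart by the
  density \<open>sqrt (det (g\<^sub>i\<^sub>j))\<close> with respect to Lebesgue measure.\<close>

definition is_riemannian_volume ::
    "('m::topological_space, 'd::finite) chart set \<Rightarrow>
     ('m \<Rightarrow> ('m, 'd) tvec \<Rightarrow> ('m, 'd) tvec \<Rightarrow> real) \<Rightarrow> 'm measure \<Rightarrow> bool" where
  "is_riemannian_volume atlas g \<mu> \<longleftrightarrow>
     sets \<mu> = sets borel \<and>
     (\<forall>c\<in>atlas. \<forall>E\<in>sets borel. E \<subseteq> chart_dom c \<longrightarrow>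
        emeasure \<mu> E =
          (\<integral>\<^sup>+x\<in>snd c ` E. ennreal (sqrt (det (gram_matrix atlas g c (chart_inv c x)))) \<partial>lborel))"


section \<open>The space of almost complex structures\<close>

definition almost_complex_structures :: "('m, 'd::finite) chart set \<Rightarrow> ('m, 'd) endo_field set" where
  "almost_complex_structures atlas = {J. smooth_endo_field atlas J \<and>
     (\<forall>p. \<forall>v\<in>tangent_space atlas p. J p (J p v) = (\<lambda>c. - v c))}"

text \<open>The tangent space of the space of almost complex structures at \<open>J\<close>.\<close>

definition End_J :: "('m, 'd::finite) chart set \<Rightarrow> ('m, 'd) endo_field \<Rightarrow> ('m, 'd) endo_field set" where
  "End_J atlas J = {K. smooth_endo_field atlas K \<and>
     (\<forall>p. \<forall>v\<in>tangent_space atlas p. lincomb 1 (J p (K p v)) 1 (K p (J p v)) = (\<lambda>_. 0))}"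

definition field_lincomb ::
    "real \<Rightarrow> ('m, 'd::finite) endo_field \<Rightarrow> real \<Rightarrow> ('m, 'd) endo_field \<Rightarrow> ('m, 'd) endo_field" where
  "field_lincomb r A s B = (\<lambda>p v. lincomb r (A p v) s (B p v))"

definition acs_chart_im ::
    "('m, 'd::finite) chart set \<Rightarrow> ('m, 'd) endo_field \<Rightarrow> ('m, 'd) endo_field set" where
  "acs_chart_im atlas J\<^sub>0 = {K \<in> End_J atlas J\<^sub>0.
     \<forall>p. bij_betw (\<lambda>v. lincomb 1 v (-1) (K p v)) (tangent_space atlas p) (tangent_space atlas p)}"

text \<open>The inverse \<open>K \<mapsto> J\<^sub>0 (1 + K) (1 - K)\<^sup>-\<^sup>1\<close> of the chart
  \<open>J \<mapsto> (1 - J J\<^sub>0)\<^sup>-\<^sup>1 (1 + J J\<^sub>0)\<close> around \<open>J\<^sub>0\<close>.\<close>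

definition acs_param ::
    "('m, 'd::finite) chart set \<Rightarrow> ('m, 'd) endo_field \<Rightarrow> ('m, 'd) endo_field \<Rightarrow> ('m, 'd) endo_field" where
  "acs_param atlas J\<^sub>0 K = (\<lambda>p v.
     let w = inv_into (tangent_space atlas p) (\<lambda>v. lincomb 1 v (-1) (K p v)) v
     in J\<^sub>0 p (lincomb 1 w 1 (K p w)))"

text \<open>Its differential at \<open>K\<close> in direction \<open>A\<close>: the velocity at \<open>t = 0\<close> of the curve
  \<open>t \<mapsto> J\<^bsub>K + tA\<^esub>\<close> of endomorphism fields, which is computed pointwise in the (finite-dimensional)
  tangent spaces of the manifold.\<close>

definition acs_param_deriv ::
    "('m, 'd::finite) chart set \<Rightarrow> ('m, 'd) endo_field \<Rightarrow> ('m, 'd) endo_field \<Rightarrow> ('m, 'd) endo_field \<Rightarrow>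
     ('m, 'd) endo_field" where
  "acs_param_deriv atlas J\<^sub>0 K A = (\<lambda>p v c.
     vector_derivative (\<lambda>t. acs_param atlas J\<^sub>0 (field_lincomb 1 K t A) p v c) (at 0))"


section \<open>Two-forms on the space of almost complex structures\<close>

type_synonym ('m, 'd) acs_form2 =
  "('m, 'd) endo_field \<Rightarrow> ('m, 'd) endo_field \<Rightarrow> ('m, 'd) endo_field \<Rightarrow> real"

text \<open>The pullback of \<open>\<omega>\<close> along the parametrization \<open>K \<mapsto> J\<^sub>K\<close>.\<close>

definition local_form ::
    "('m, 'd::finite) chart set \<Rightarrow> ('m, 'd) acs_form2 \<Rightarrow> ('m, 'd) endo_field \<Rightarrow> ('m, 'd) acs_form2" where
  "local_form atlas \<omega> J\<^sub>0 K A B =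
     \<omega> (acs_param atlas J\<^sub>0 K) (acs_param_deriv atlas J\<^sub>0 K A) (acs_param_deriv atlas J\<^sub>0 K B)"

text \<open>Differentiability in charts means that the directional derivatives entering the exterior
  derivative exist.\<close>

definition two_form :: "('m, 'd::finite) chart set \<Rightarrow> ('m, 'd) acs_form2 \<Rightarrow> bool" where
  "two_form atlas \<omega> \<longleftrightarrow>
     (\<forall>J\<in>almost_complex_structures atlas. \<forall>A\<in>End_J atlas J. \<forall>B\<in>End_J atlas J.
        \<omega> J A B = - \<omega> J B A \<and>
        (\<forall>C\<in>End_J atlas J. \<forall>r s. \<omega> J (field_lincomb r A s B) C = r * \<omega> J A C + s * \<omega> J B C)) \<and>
     (\<forall>J\<^sub>0\<in>almost_complex_structures atlas. \<forall>K\<in>acs_chart_im atlas J\<^sub>0.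
      \<forall>A\<in>End_J atlas J\<^sub>0. \<forall>B\<in>End_J atlas J\<^sub>0. \<forall>C\<in>End_J atlas J\<^sub>0.
        (\<lambda>t. local_form atlas \<omega> J\<^sub>0 (field_lincomb 1 K t A) B C) differentiable (at 0))"

text \<open>The exterior derivative of \<open>\<omega>\<close> in the chart around \<open>J\<^sub>0\<close>, at the point \<open>K\<close> of the model space
  and evaluated on the constant vector fields \<open>A\<close>, \<open>B\<close>, \<open>C\<close> (whose Lie brackets vanish).\<close>

definition local_ext_deriv ::
    "('m, 'd::finite) chart set \<Rightarrow> ('m, 'd) acs_form2 \<Rightarrow> ('m, 'd) endo_field \<Rightarrow> ('m, 'd) endo_field \<Rightarrow>
     ('m, 'd) endo_field \<Rightarrow> ('m, 'd) endo_field \<Rightarrow> ('m, 'd) endo_field \<Rightarrow> real" where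
  "local_ext_deriv atlas \<omega> J\<^sub>0 K A B C =
       deriv (\<lambda>t. local_form atlas \<omega> J\<^sub>0 (field_lincomb 1 K t A) B C) 0
     - deriv (\<lambda>t. local_form atlas \<omega> J\<^sub>0 (field_lincomb 1 K t B) A C) 0
     + deriv (\<lambda>t. local_form atlas \<omega> J\<^sub>0 (field_lincomb 1 K t C) A B) 0"

definition closed_two_form :: "('m, 'd::finite) chart set \<Rightarrow> ('m, 'd) acs_form2 \<Rightarrow> bool" where
  "closed_two_form atlas \<omega> \<longleftrightarrow> two_form atlas \<omega> \<and>
     (\<forall>J\<^sub>0\<in>almost_complex_structures atlas. \<forall>K\<in>acs_chart_im atlas J\<^sub>0.
      \<forall>A\<in>End_J atlas J\<^sub>0. \<forall>B\<in>End_J atlas J\<^sub>0. \<forall>C\<in>End_J atlas J\<^sub>0.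
        local_ext_deriv atlas \<omega> J\<^sub>0 K A B C = 0)"

definition weak_metric ::
    "('m, 'd::finite) chart set \<Rightarrow> 'm measure \<Rightarrow> ('m, 'd) endo_field \<Rightarrow> ('m, 'd) endo_field \<Rightarrow> real" where
  "weak_metric atlas \<mu> A B = (\<integral>p. endo_trace atlas p (A p \<circ> B p) \<partial>\<mu>)"

definition acs_complex_structure ::
    "('m, 'd) endo_field \<Rightarrow> ('m, 'd) endo_field \<Rightarrow> ('m, 'd) endo_field" where
  "acs_complex_structure J A = (\<lambda>p. A p \<circ> J p)"

definition fundamental_form :: "('m, 'd::finite) chart set \<Rightarrow> 'm measure \<Rightarrow> ('m, 'd) acs_form2" where
  "fundamental_form atlas \<mu> J A B = weak_metric atlas \<mu> (acs_complex_structure J A) B"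

end

(* In the chart around J0, with P = (1 - K^2)^-1, the form at K becomes
   (B, C) |-> -4 * (integral of tr (J0 P B P C)).  Conjugation by J0 turns tr (J0 X Y) into
   -tr (J0 Y X) whenever X anticommutes with J0; applied to K, P A, P B and P C, this makes the
   alternating sum of the derivatives in the directions A, B, C vanish pointwise.  By compactness
   of M, the coordinate matrices of all fields involved lie in one compact set on which 1 - K^2 is
   invertible, which gives the uniform bounds for differentiating under the integral. *)

theory Submission
  imports Defs
begin

section \<open>Matrix calculus\<close>

text \<open>With R = (1 - K)^-1, the differential of K -> J_K in direction B is 2 J0 R B R, because
  (1 + K) R = 2 R - 1. Conjugation by J0 exchanges 1 - K and 1 + K, so moving J0 past R produces (1
  + K)^-1; this cancels the numerator of J_K and completes the remaining factors R to P. Two factors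
  2 and J0^2 = -1 account for the -4. The matrices depend on a chart although the integrand does
  not, so every point gets a chart of its own, through a choice function about whose measurability
  nothing is known. The integrand is therefore shown to be continuous on each chart domain in the
  coordinates of that chart, using that the trace is chart independent; the derivative of the
  integrand is measurable as a limit of difference quotients. The choice function is confined to
  finitely many compact coordinate pieces, which also shows that the volume is finite, so that
  constants can serve as dominating functions.\<close>

lemma has_vector_derivative_iff_tendsto:
  fixes f :: "real \<Rightarrow> 'a::real_normed_vector"
  shows "(f has_vector_derivative D) (at t) \<longleftrightarrow> ((\<lambda>s. (f s - f t) /\<^sub>R (s - t)) \<longlongrightarrow> D) (at t)"
proof -
  have eq: "norm (f s - f t - (s - t) *\<^sub>R D) / norm (s - t) = norm ((f s - f t) /\<^sub>R (s - t) - D)"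
    if "s \<noteq> t" for s
  proof -
    have "(f s - f t) /\<^sub>R (s - t) - D = (f s - f t - (s - t) *\<^sub>R D) /\<^sub>R (s - t)"
      using that by (simp add: scaleR_diff_right)
    then show ?thesis
      by (simp add: divide_inverse mult.commute)
  qed
  have "(f has_vector_derivative D) (at t) \<longleftrightarrow>
    ((\<lambda>s. norm (f s - f t - (s - t) *\<^sub>R D) / norm (s - t)) \<longlongrightarrow> 0) (at t)"
    unfolding has_vector_derivative_def has_derivative_iff_norm
    by (simp add: bounded_linear_scaleR_left)
  also have "\<dots> \<longleftrightarrow> ((\<lambda>s. norm ((f s - f t) /\<^sub>R (s - t) - D)) \<longlongrightarrow> 0) (at t)"
    by (rule tendsto_cong) (simp add: eventually_at_filter eq del: real_norm_def)
  also have "\<dots> \<longleftrightarrow> ((\<lambda>s. (f s - f t) /\<^sub>R (s - t)) \<longlongrightarrow> D) (at t)"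
    by (simp only: tendsto_norm_zero_iff LIM_zero_iff)
  finally show ?thesis .
qed

lemma bounded_bilinear_matrix_mult:
  "bounded_bilinear ((**) :: real^'n^'m \<Rightarrow> real^'k^'n \<Rightarrow> real^'k^'m)"
  unfolding bilinear_conv_bounded_bilinear[symmetric] bilinear_def
  by (auto intro!: linearI simp: vec_eq_iff matrix_matrix_mult_def sum.distrib sum_distrib_left algebra_simps)

interpretation matrix_mult: bounded_bilinear "(**) :: real^'n^'m \<Rightarrow> real^'k^'n \<Rightarrow> real^'k^'m"
  by (rule bounded_bilinear_matrix_mult)

lemma bounded_linear_trace: "bounded_linear (trace :: real^'n^'n \<Rightarrow> real)"
  unfolding linear_conv_bounded_linear[symmetric]
  by (auto intro!: linearI simp: trace_add) (simp add: trace_def sum_distrib_left)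

lemmas trace_simps = linear_simps[OF bounded_linear_trace]

lemma continuous_on_det:
  fixes f :: "'a::topological_space \<Rightarrow> real^'n^'n"
  shows "continuous_on S f \<Longrightarrow> continuous_on S (\<lambda>x. det (f x))"
  unfolding det_def by (intro continuous_intros)

lemma matrix_inv_inverse:
  fixes A :: "real^'n^'n"
  assumes "invertible A"
  shows "A ** matrix_inv A = mat 1" "matrix_inv A ** A = mat 1"
proof -
  have "A ** matrix_inv A = mat 1 \<and> matrix_inv A ** A = mat 1"
    using someI_ex[of "\<lambda>B. A ** B = mat 1 \<and> B ** A = mat 1"] assms
    unfolding invertible_def matrix_inv_def by blast
  then show "A ** matrix_inv A = mat 1" "matrix_inv A ** A = mat 1" by auto
qed

lemma matrix_inv_eqI:
  fixes A B :: "real^'n^'n"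
  assumes "A ** B = mat 1"
  shows "matrix_inv A = B"
proof -
  have "invertible A" using assms invertible_right_inverse by blast
  then have "matrix_inv A ** (A ** B) = B"
    by (simp add: matrix_mul_assoc matrix_inv_inverse)
  with assms show ?thesis by simp
qed

text \<open>Column l of the inverse solves A x = e_l, and Cramer's rule solves that equation. The
  gain is that every entry of the inverse becomes a quotient of polynomials in the entries of A,
  which is how continuity of inversion is obtained.\<close>

lemma matrix_inv_cramer:
  fixes A :: "real^'n^'n"
  assumes "invertible A"
  shows "matrix_inv A = (\<chi> k l. det (\<chi> i j. if j = k then axis l 1 $ i else A$i$j) / det A)"
proof -
  have "column l (matrix_inv A) = (\<chi> k. det (\<chi> i j. if j = k then axis l 1 $ i else A$i$j) / det A)" for l
  proof -
    have "A *v column l (matrix_inv A) = axis l 1"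
      using assms by (metis matrix_vector_mul_assoc matrix_inv_inverse(1) matrix_vector_mul_lid matrix_vector_mult_basis)
    then show ?thesis
      using cramer[of A "column l (matrix_inv A)" "axis l 1"] assms by (simp add: invertible_det_nz)
  qed
  then show ?thesis
    by (simp add: column_def vec_eq_iff)
qed

lemma continuous_on_matrix_inv:
  fixes f :: "'a::topological_space \<Rightarrow> real^'n^'n"
  assumes "continuous_on S f" "\<And>x. x \<in> S \<Longrightarrow> invertible (f x)"
  shows "continuous_on S (\<lambda>x. matrix_inv (f x))"
proof -
  have entry: "continuous_on S (\<lambda>x. if j = k then axis l 1 $ i else f x $ i $ j)" for i j k l
    by (cases "j = k") (simp_all add: continuous_on_component assms(1))
  have "continuous_on S (\<lambda>x. (\<chi> k l. det (\<chi> i j. if j = k then axis l 1 $ i else f x$i$j) / det (f x)))"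
    by (intro continuous_on_vec_lambda continuous_on_divide continuous_on_det assms(1))
      (auto intro!: continuous_on_component assms(1) simp: assms(2)[unfolded invertible_det_nz] entry)
  then show ?thesis
    by (rule continuous_on_eq) (simp add: assms(2) matrix_inv_cramer)
qed

lemma open_invertible: "open {A :: real^'n^'n. invertible A}"
proof -
  have "{A :: real^'n^'n. invertible A} = det -` (- {0})"
    by (auto simp: invertible_det_nz)
  moreover have "open (det -` (- {0}) :: (real^'n^'n) set)"
    by (intro open_vimage continuous_on_det continuous_on_id) auto
  ultimately show ?thesis by simp
qed

text \<open>The identity X^-1 - Y^-1 = - X^-1 (X - Y) Y^-1 turns the difference quotient of the
  inverses into an exact expression in that of \<open>f\<close>; continuity of inversion then gives
  the limit. The identity is available near \<open>t\<close> because the invertible matrices form an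
  open set.\<close>

lemma has_vector_derivative_matrix_inv:
  fixes f :: "real \<Rightarrow> real^'n^'n"
  assumes f: "(f has_vector_derivative D) (at t)" and inv: "invertible (f t)"
  shows "((\<lambda>s. matrix_inv (f s)) has_vector_derivative
    - (matrix_inv (f t) ** D ** matrix_inv (f t))) (at t)"
proof -
  let ?g = "\<lambda>s. matrix_inv (f s)"
  have cont: "f \<midarrow>t\<rightarrow> f t"
    using has_vector_derivative_continuous[OF f] by (simp add: continuous_at)
  have ev: "\<forall>\<^sub>F s in at t. invertible (f s)"
    using topological_tendstoD[OF cont open_invertible] inv by simp
  have "continuous_on {A :: real^'n^'n. invertible A} matrix_inv"
    by (rule continuous_on_matrix_inv) auto
  then have "isCont matrix_inv (f t)"
    using continuous_on_eq_continuous_at[OF open_invertible] inv by blast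
  then have g: "?g \<midarrow>t\<rightarrow> ?g t"
    using cont by (rule isCont_tendsto_compose)
  have "((\<lambda>s. - (?g s ** ((f s - f t) /\<^sub>R (s - t)) ** ?g t)) \<longlongrightarrow> - (?g t ** D ** ?g t)) (at t)"
    using f[unfolded has_vector_derivative_iff_tendsto] g
    by (intro tendsto_minus matrix_mult.tendsto tendsto_const)
  moreover have "\<forall>\<^sub>F s in at t. - (?g s ** ((f s - f t) /\<^sub>R (s - t)) ** ?g t) = (?g s - ?g t) /\<^sub>R (s - t)"
    using ev
  proof eventually_elim
    case (elim s)
    have "- (?g s ** (f s - f t) ** ?g t) = ?g s - ?g t"
      using matrix_inv_inverse[OF elim] matrix_inv_inverse[OF inv]
      by (simp add: matrix_mult.diff_left matrix_mult.diff_right matrix_mul_assoc[symmetric])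
    then show ?case
      by (simp only: matrix_mult.scaleR_left matrix_mult.scaleR_right scaleR_minus_right[symmetric])
  qed
  ultimately show ?thesis
    unfolding has_vector_derivative_iff_tendsto by (rule Lim_transform_eventually)
qed

section \<open>The local form as a function of matrices\<close>

text \<open>The integrand of the pulled back form at one point of the manifold, in the coordinates
  of one chart; \<open>trace_eq_form_density\<close> derives it from the definition of the
  form.\<close>

definition form_density :: "real^'n^'n \<Rightarrow> real^'n^'n \<Rightarrow> real^'n^'n \<Rightarrow> real^'n^'n \<Rightarrow> real" where
  "form_density J K B C = (let P = matrix_inv (mat 1 - K ** K) in - 4 * trace (J ** P ** B ** P ** C))"

text \<open>The derivative of \<open>form_density\<close> at K in direction A. Here L is the
  variation of K^2, so P varies by P L P, and each of the two occurrences of P contributes one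
  summand.\<close>

definition form_density_deriv ::
    "real^'n^'n \<Rightarrow> real^'n^'n \<Rightarrow> real^'n^'n \<Rightarrow> real^'n^'n \<Rightarrow> real^'n^'n \<Rightarrow> real" where
  "form_density_deriv J K A B C = (let P = matrix_inv (mat 1 - K ** K); L = K ** A + A ** K in
     - 4 * (trace (J ** P ** L ** P ** B ** P ** C) + trace (J ** P ** B ** P ** L ** P ** C)))"

lemma has_vector_derivative_line:
  "((\<lambda>s. K + s *\<^sub>R A) has_vector_derivative A) (at t)"
  by (auto intro!: derivative_eq_intros)

lemma form_density_has_derivative:
  assumes inv: "invertible (mat 1 - (K + t *\<^sub>R A) ** (K + t *\<^sub>R A))"
  shows "((\<lambda>s. form_density J (K + s *\<^sub>R A) B C) has_real_derivative
    form_density_deriv J (K + t *\<^sub>R A) A B C) (at t)"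
proof -
  let ?K = "\<lambda>s. K + s *\<^sub>R A"
  let ?P = "\<lambda>s. matrix_inv (mat 1 - ?K s ** ?K s)"
  let ?L = "?K t ** A + A ** ?K t"
  have "((\<lambda>s. mat 1 - ?K s ** ?K s) has_vector_derivative 0 - ?L) (at t)"
    by (intro has_vector_derivative_diff has_vector_derivative_const
        matrix_mult.has_vector_derivative has_vector_derivative_line)
  from has_vector_derivative_matrix_inv[OF this inv]
  have P: "(?P has_vector_derivative ?P t ** ?L ** ?P t) (at t)"
    by (simp only: diff_0 matrix_mult.minus_left matrix_mult.minus_right minus_minus)
  have "((\<lambda>s. J ** ?P s ** B ** ?P s ** C) has_vector_derivative
     (J ** ?P t ** B) ** (?P t ** ?L ** ?P t) ** C + J ** (?P t ** ?L ** ?P t) ** B ** ?P t ** C) (at t)"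
    (is "(_ has_vector_derivative ?D) _")
    by (rule has_vector_derivative_eq_rhs)
      (rule matrix_mult.has_vector_derivative[OF matrix_mult.has_vector_derivative[OF matrix_mult.has_vector_derivative[OF matrix_mult.has_vector_derivative[OF has_vector_derivative_const P]
       has_vector_derivative_const] P] has_vector_derivative_const],
       simp add: matrix_mult.add_left)
  from bounded_linear.has_vector_derivative[OF bounded_linear_trace this]
  have "((\<lambda>s. trace (J ** ?P s ** B ** ?P s ** C)) has_real_derivative trace ?D) (at t)"
    by (simp add: has_real_derivative_iff_has_vector_derivative)
  from DERIV_cmult[OF this, of "-4"] show ?thesis
    unfolding form_density_def form_density_deriv_def Let_def
    by (simp add: trace_simps matrix_mul_assoc add.commute)
qed

lemma continuous_on_form_density_deriv:
  fixes J K A B C :: "'a::topological_space \<Rightarrow> real^'n^'n"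
  assumes "continuous_on S J" "continuous_on S K" "continuous_on S A" "continuous_on S B" "continuous_on S C"
    and "\<And>x. x \<in> S \<Longrightarrow> invertible (mat 1 - K x ** K x)"
  shows "continuous_on S (\<lambda>x. form_density_deriv (J x) (K x) (A x) (B x) (C x))"
  unfolding form_density_deriv_def Let_def
  by (intro continuous_intros bounded_linear.continuous_on[OF bounded_linear_trace]
      matrix_mult.continuous_on continuous_on_matrix_inv assms)

lemma continuous_on_form_density:
  fixes J K B C :: "'a::topological_space \<Rightarrow> real^'n^'n"
  assumes "continuous_on S J" "continuous_on S K" "continuous_on S B" "continuous_on S C"
    and "\<And>x. x \<in> S \<Longrightarrow> invertible (mat 1 - K x ** K x)"
  shows "continuous_on S (\<lambda>x. form_density (J x) (K x) (B x) (C x))"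
  unfolding form_density_def Let_def
  by (intro continuous_intros bounded_linear.continuous_on[OF bounded_linear_trace]
      matrix_mult.continuous_on continuous_on_matrix_inv assms)

text \<open>The compact set \<open>{0} \<times> S\<close> lies in the open set \<open>W\<close> of
  parameters for which 1 - (K + t A)^2 is invertible, so a whole slab of small t does too. That slab
  is compact and the derivative is continuous on it, hence bounded. The width
  \<open>\<delta>\<close> and the bound \<open>b\<close> hold for all tuples in \<open>S\<close> at
  once, which is what differentiation under the integral requires.\<close>

lemma form_density_uniform:
  fixes S :: "((real^'n^'n) \<times> (real^'n^'n) \<times> (real^'n^'n) \<times> (real^'n^'n) \<times> (real^'n^'n)) set"
  assumes S: "compact S"
    and inv: "\<And>J K A B C. (J, K, A, B, C) \<in> S \<Longrightarrow> invertible (mat 1 - K ** K)"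
  obtains \<delta> b where "\<delta> > 0"
    "\<And>t J K A B C. \<bar>t\<bar> \<le> \<delta> \<Longrightarrow> (J, K, A, B, C) \<in> S \<Longrightarrow>
       invertible (mat 1 - (K + t *\<^sub>R A) ** (K + t *\<^sub>R A)) \<and>
       \<bar>form_density_deriv J (K + t *\<^sub>R A) A B C\<bar> \<le> b"
proof -
  define Kt :: "real \<times> (real^'n^'n) \<times> (real^'n^'n) \<times> (real^'n^'n) \<times> (real^'n^'n) \<times> (real^'n^'n) \<Rightarrow> real^'n^'n"
    where "Kt = (\<lambda>(t, J, K, A, B, C). K + t *\<^sub>R A)"
  have Kt: "continuous_on X Kt" for X
    unfolding Kt_def case_prod_unfold by (intro continuous_intros)
  define W where "W = {x. invertible (mat 1 - Kt x ** Kt x)}"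
  have "open ((\<lambda>x. mat 1 - Kt x ** Kt x) -` {A. invertible A})"
    by (intro open_vimage open_invertible continuous_intros matrix_mult.continuous_on Kt)
  then have W: "open W"
    by (simp add: W_def vimage_def)
  have "{0} \<times> S \<subseteq> W"
    using inv by (auto simp: W_def Kt_def)
  moreover have "compact ({0} \<times> S)"
    using S by (intro compact_Times) auto
  ultimately obtain \<epsilon> where e: "\<epsilon> > 0" "(\<Union>x\<in>{0} \<times> S. ball x \<epsilon>) \<subseteq> W"
    using compact_subset_open_imp_ball_epsilon_subset W by metis
  \<comment> \<open>A closed interval keeps the slab compact; half of \<open>\<epsilon>\<close>
    keeps it inside the open balls of radius \<open>\<epsilon>\<close>.\<close>
  define T where "T = {- \<epsilon>/2..\<epsilon>/2} \<times> S"
  have TW: "T \<subseteq> W"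
  proof
    fix x assume "x \<in> T"
    then obtain t z where x: "x = (t, z)" "z \<in> S" "\<bar>t\<bar> \<le> \<epsilon>/2" by (auto simp: T_def)
    then have "x \<in> ball (0, z) \<epsilon>"
      using e(1) by (simp add: dist_Pair_Pair)
    then show "x \<in> W" using e(2) x(2) by blast
  qed
  have "continuous_on T (\<lambda>x. form_density_deriv (fst (snd x)) (Kt x) (fst (snd (snd (snd x))))
      (fst (snd (snd (snd (snd x))))) (snd (snd (snd (snd (snd x))))))"
    using TW by (intro continuous_on_form_density_deriv Kt continuous_intros) (auto simp: W_def)
  moreover have "compact T"
    unfolding T_def by (intro compact_Times S compact_Icc)
  ultimately have "bounded ((\<lambda>x. form_density_deriv (fst (snd x)) (Kt x) (fst (snd (snd (snd x))))
      (fst (snd (snd (snd (snd x))))) (snd (snd (snd (snd (snd x)))))) ` T)"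
    using compact_continuous_image compact_imp_bounded by blast
  then obtain b where b: "\<And>x. x \<in> T \<Longrightarrow> \<bar>form_density_deriv (fst (snd x)) (Kt x) (fst (snd (snd (snd x))))
      (fst (snd (snd (snd (snd x))))) (snd (snd (snd (snd (snd x)))))\<bar> \<le> b"
    unfolding bounded_iff by auto
  show thesis
  proof
    show "\<epsilon>/2 > 0" using e(1) by simp
    fix t J K A B C assume "\<bar>t\<bar> \<le> \<epsilon>/2" "(J, K, A, B, C) \<in> S"
    then have "(t, J, K, A, B, C) \<in> T" by (auto simp: T_def)
    then show "invertible (mat 1 - (K + t *\<^sub>R A) ** (K + t *\<^sub>R A)) \<and>
       \<bar>form_density_deriv J (K + t *\<^sub>R A) A B C\<bar> \<le> b"
      using TW b[of "(t, J, K, A, B, C)"] by (auto simp: W_def Kt_def)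
  qed
qed

text \<open>The product rule gives J (1 + K) R A R + J A R. Writing 1 + K = 2 - (1 - K) gives (1 +
  K) R = 2 R - 1, and the two terms J A R cancel.\<close>

lemma cayley_has_vector_derivative:
  fixes J K A :: "real^'n^'n"
  assumes inv: "invertible (mat 1 - K)"
  defines "R \<equiv> matrix_inv (mat 1 - K)"
  shows "((\<lambda>s. J ** (mat 1 + (K + s *\<^sub>R A)) ** matrix_inv (mat 1 - (K + s *\<^sub>R A)))
    has_vector_derivative 2 *\<^sub>R (J ** R ** A ** R)) (at 0)"
proof -
  let ?K = "\<lambda>s. K + s *\<^sub>R A"
  have "((\<lambda>s. mat 1 - ?K s) has_vector_derivative 0 - A) (at 0)"
    by (intro has_vector_derivative_diff has_vector_derivative_const has_vector_derivative_line)
  from has_vector_derivative_matrix_inv[OF this]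
  have R: "((\<lambda>s. matrix_inv (mat 1 - ?K s)) has_vector_derivative R ** A ** R) (at 0)"
    using inv by (simp add: R_def matrix_mult.minus_left matrix_mult.minus_right)
  have "((\<lambda>s. mat 1 + ?K s) has_vector_derivative 0 + A) (at 0)"
    by (intro has_vector_derivative_add has_vector_derivative_const has_vector_derivative_line)
  from matrix_mult.has_vector_derivative[OF matrix_mult.has_vector_derivative[OF has_vector_derivative_const this] R]
  have "((\<lambda>s. J ** (mat 1 + ?K s) ** matrix_inv (mat 1 - ?K s)) has_vector_derivative
     J ** (mat 1 + K) ** (R ** A ** R) + J ** A ** R) (at 0)"
    by (simp add: R_def)
  moreover have "J ** (mat 1 + K) ** (R ** A ** R) + J ** A ** R = 2 *\<^sub>R (J ** R ** A ** R)"
  proof -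
    have "(mat 1 + K) ** R = (2 *\<^sub>R mat 1 - (mat 1 - K)) ** R"
      by (simp add: scaleR_2)
    also have "\<dots> = 2 *\<^sub>R R - mat 1"
      using matrix_inv_inverse[OF inv]
      by (simp only: matrix_mult.diff_left matrix_mult.scaleR_left R_def) simp
    finally have "J ** ((mat 1 + K) ** R) ** A ** R = 2 *\<^sub>R (J ** R ** A ** R) - J ** A ** R"
      by (simp add: matrix_mult.diff_left matrix_mult.diff_right matrix_mult.scaleR_left matrix_mult.scaleR_right)
    then show ?thesis by (simp add: matrix_mul_assoc)
  qed
  ultimately show ?thesis by simp
qed

lemma matrix_inv_commute:
  fixes Q X :: "real^'n^'n"
  assumes "invertible Q" "Q ** X = X ** Q"
  shows "matrix_inv Q ** X = X ** matrix_inv Q"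
proof -
  have "matrix_inv Q ** (Q ** X) ** matrix_inv Q = matrix_inv Q ** (X ** Q) ** matrix_inv Q"
    by (simp add: assms(2))
  then show ?thesis
    using matrix_inv_inverse[OF assms(1)]
    by (simp add: matrix_mul_assoc) (simp add: matrix_mul_assoc[symmetric])
qed

text \<open>J passes X at the cost of a sign, and cyclicity of the trace then carries the leading X
  to the end.\<close>

lemma trace_anticommute_rotate:
  fixes J X Y :: "real^'n^'n"
  assumes "J ** X = - (X ** J)"
  shows "trace (J ** (X ** Y)) = - trace (J ** (Y ** X))"
proof -
  have "trace (J ** (X ** Y)) = trace (- (X ** (J ** Y)))"
    by (simp add: matrix_mul_assoc assms matrix_mult.minus_left)
  also have "\<dots> = - trace (J ** Y ** X)"
    by (simp add: trace_simps) (metis trace_mul_sym)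
  finally show ?thesis by (simp add: matrix_mul_assoc)
qed

section \<open>Algebra of a complex structure J and an endomorphism K anticommuting with it\<close>

context
  fixes J K :: "real^'n^'n"
  assumes J: "J ** J = - mat 1" and K: "J ** K = - (K ** J)"
begin

text \<open>Since J^-1 = -J, the matrix \<open>S\<close> is the conjugate J^-1 R J. Conjugation by J
  sends K to -K, hence 1 - K to 1 + K, so \<open>S\<close> is the inverse of 1 + K. The
  factorization 1 - K^2 = (1 - K) (1 + K) then yields the inverse \<open>S ** R\<close>.\<close>

lemma cayley_inverses:
  assumes "invertible (mat 1 - K)"
  defines "R \<equiv> matrix_inv (mat 1 - K)"
  defines "S \<equiv> - (J ** R ** J)"
  shows "S ** (mat 1 + K) = mat 1" "R ** J = J ** S"
    "invertible (mat 1 - K ** K)" "matrix_inv (mat 1 - K ** K) = S ** R"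
proof -
  have R: "(mat 1 - K) ** R = mat 1"
    using matrix_inv_inverse[OF assms(1)] by (auto simp: R_def)
  have swap: "(mat 1 + K) ** J = J ** (mat 1 - K)"
    by (simp add: matrix_mult.add_left matrix_mult.diff_right K)
  have "(mat 1 + K) ** S = - ((mat 1 + K) ** J ** R ** J)"
    by (simp add: S_def matrix_mult.minus_right matrix_mul_assoc)
  also have "\<dots> = - (J ** ((mat 1 - K) ** R) ** J)"
    unfolding swap by (simp add: matrix_mul_assoc)
  finally have S: "(mat 1 + K) ** S = mat 1"
    by (simp add: R J)
  then show "S ** (mat 1 + K) = mat 1"
    using matrix_left_right_inverse by blast
  have "(mat 1 - K ** K) = (mat 1 - K) ** (mat 1 + K)"
    by (simp add: matrix_mult.diff_left matrix_mult.add_right)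
  then have "(mat 1 - K ** K) ** (S ** R) = (mat 1 - K) ** ((mat 1 + K) ** S) ** R"
    by (simp add: matrix_mul_assoc)
  then have 1: "(mat 1 - K ** K) ** (S ** R) = mat 1"
    by (simp add: S R)
  show "invertible (mat 1 - K ** K)"
    using 1 invertible_right_inverse by blast
  show "matrix_inv (mat 1 - K ** K) = S ** R"
    using 1 by (rule matrix_inv_eqI)
  have "J ** (J ** R ** J) = J ** J ** R ** J"
    by (simp add: matrix_mul_assoc)
  also have "\<dots> = - (R ** J)"
    unfolding J by (simp add: matrix_mult.minus_left)
  finally show "R ** J = J ** S"
    by (simp add: S_def matrix_mult.minus_right)
qed

text \<open>The chart image is described by 1 - K, whereas the density involves 1 - K^2.
  Anticommutation with J is what lets invertibility of 1 - K imply that of 1 + K; the converse is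
  multiplicativity of the determinant.\<close>

lemma invertible_one_minus:
  "invertible (mat 1 - K) \<longleftrightarrow> invertible (mat 1 - K ** K)"
proof
  assume "invertible (mat 1 - K ** K)"
  moreover have "(mat 1 - K ** K) = (mat 1 - K) ** (mat 1 + K)"
    by (simp add: matrix_mult.diff_left matrix_mult.add_right)
  ultimately show "invertible (mat 1 - K)"
    by (simp add: invertible_det_nz det_mul)
qed (rule cayley_inverses(3))

text \<open>Both inner products R J become J S. The first S cancels 1 + K, the second combines with
  the following R to P, and the two copies of J that now meet give -1. Cyclicity brings the last R
  to the front, where R J R = J S R = J P supplies the other P.\<close>

lemma trace_eq_form_density:
  assumes "invertible (mat 1 - K)"
  defines "R \<equiv> matrix_inv (mat 1 - K)"
  shows "trace ((2 *\<^sub>R (J ** R ** B ** R)) ** (J ** (mat 1 + K) ** R) ** (2 *\<^sub>R (J ** R ** C ** R)))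
    = form_density J K B C"
proof -
  define S where "S = - (J ** R ** J)"
  note * = cayley_inverses[OF assms(1), folded R_def, folded S_def]
  define P where "P = matrix_inv (mat 1 - K ** K)"
  have P: "P = S ** R" using * by (simp add: P_def)
  have "J ** R ** B ** R ** (J ** (mat 1 + K) ** R) ** (J ** R ** C ** R)
    = J ** R ** B ** (R ** J) ** (mat 1 + K) ** (R ** J) ** R ** C ** R"
    by (simp only: matrix_mul_assoc)
  also have "\<dots> = J ** R ** B ** J ** (S ** (mat 1 + K)) ** (J ** S) ** R ** C ** R"
    unfolding *(2) by (simp only: matrix_mul_assoc)
  also have "\<dots> = J ** R ** B ** (J ** J) ** P ** C ** R"
    unfolding *(1) P by (simp add: matrix_mul_assoc)
  also have "\<dots> = - (J ** R ** B ** P ** C ** R)"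
    unfolding J by (simp add: matrix_mult.minus_left matrix_mult.minus_right)
  finally have 1: "J ** R ** B ** R ** (J ** (mat 1 + K) ** R) ** (J ** R ** C ** R)
    = - (J ** R ** B ** P ** C ** R)" .
  have "trace (J ** R ** B ** P ** C ** R) = trace (R ** (J ** R ** B ** P ** C))"
    by (rule trace_mul_sym)
  also have "\<dots> = trace (J ** P ** B ** P ** C)"
    by (simp add: matrix_mul_assoc *(2) P)
  finally show ?thesis
    using 1 by (simp add: matrix_mult.scaleR_left matrix_mult.scaleR_right trace_simps
        form_density_def Let_def P_def)
qed

text \<open>P commutes with K and, since K^2 commutes with J, also with J. Thus P A, P B and P C
  anticommute with J just as A, B and C do, and they may be rotated under the trace twisted by
  J.\<close>

lemma form_density_deriv_cyclic:
  assumes A: "J ** A = - (A ** J)" and B: "J ** B = - (B ** J)" and C: "J ** C = - (C ** J)"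
    and inv: "invertible (mat 1 - K ** K)"
  shows "form_density_deriv J K A B C - form_density_deriv J K B A C + form_density_deriv J K C A B = 0"
proof -
  define P where "P = matrix_inv (mat 1 - K ** K)"
  have PK: "P ** K = K ** P"
    unfolding P_def using inv
    by (rule matrix_inv_commute) (simp add: matrix_mult.diff_left matrix_mult.diff_right matrix_mul_assoc)
  have "K ** K ** J = J ** (K ** K)"
  proof -
    have KJ: "K ** J = - (J ** K)" using K by simp
    have "K ** (K ** J) = K ** (- (J ** K))"
      by (simp only: KJ)
    also have "\<dots> = - (K ** J ** K)"
      by (simp only: matrix_mult.minus_right matrix_mul_assoc)
    also have "\<dots> = J ** (K ** K)"
      by (simp only: KJ matrix_mult.minus_left matrix_mul_assoc minus_minus)
    finally show ?thesis by (simp only: matrix_mul_assoc)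
  qed
  then have PJ: "P ** J = J ** P"
    unfolding P_def using inv
    by (intro matrix_inv_commute) (auto simp add: matrix_mult.diff_left matrix_mult.diff_right)
  define \<tau> where "\<tau> X = trace (J ** X)" for X
  have rot: "\<tau> ((P ** X) ** Y) = - \<tau> (Y ** (P ** X))" if "J ** X = - (X ** J)" for X Y
    unfolding \<tau>_def
  proof (rule trace_anticommute_rotate)
    have "J ** (P ** X) = P ** (J ** X)"
      by (simp add: matrix_mul_assoc PJ)
    then show "J ** (P ** X) = - (P ** X ** J)"
      by (simp add: that matrix_mult.minus_right matrix_mul_assoc)
  qed
  \<comment> \<open>Normal form: rotations, each costing a sign, are applied until K leads the word.
    Every derivative then consists of four words in K followed by a permutation of P X, P Y, P Z,
    and the twelve words of the alternating sum cancel in pairs.\<close>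
  have expand: "form_density_deriv J K X Y Z =
      - 4 * (\<tau> (K ** (P ** X) ** (P ** Y) ** (P ** Z)) - \<tau> (K ** (P ** Y) ** (P ** Z) ** (P ** X))
        - \<tau> (K ** (P ** X) ** (P ** Z) ** (P ** Y)) + \<tau> (K ** (P ** Z) ** (P ** Y) ** (P ** X)))"
    if X: "J ** X = - (X ** J)" and Y: "J ** Y = - (Y ** J)" and Z: "J ** Z = - (Z ** J)" for X Y Z
  proof -
    let ?x = "P ** X" and ?y = "P ** Y" and ?z = "P ** Z"
    have 1: "trace (J ** P ** (K ** X + X ** K) ** P ** Y ** P ** Z) =
        \<tau> ((P ** K) ** X ** ?y ** ?z) + \<tau> (?x ** (K ** ?y ** ?z))"
      by (simp add: \<tau>_def matrix_mult.add_left matrix_mult.add_right trace_add matrix_mul_assoc)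
    have 2: "trace (J ** P ** Y ** P ** (K ** X + X ** K) ** P ** Z) =
        \<tau> (?y ** ((P ** K) ** X ** ?z)) + \<tau> (?y ** (?x ** K ** ?z))"
      by (simp add: \<tau>_def matrix_mult.add_left matrix_mult.add_right trace_add matrix_mul_assoc)
    have "\<tau> ((P ** K) ** X ** ?y ** ?z) = \<tau> (K ** ?x ** ?y ** ?z)"
      unfolding PK by (simp add: matrix_mul_assoc)
    moreover have "\<tau> (?x ** (K ** ?y ** ?z)) = - \<tau> (K ** ?y ** ?z ** ?x)"
      by (rule rot[OF X])
    moreover have "\<tau> (?y ** ((P ** K) ** X ** ?z)) = - \<tau> (K ** ?x ** ?z ** ?y)"
      unfolding rot[OF Y] PK by (simp add: matrix_mul_assoc)
    moreover have "\<tau> (?y ** (?x ** K ** ?z)) = - \<tau> (?x ** (K ** ?z ** ?y))"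
      unfolding rot[OF Y] by (simp add: matrix_mul_assoc)
    moreover have "\<tau> (?x ** (K ** ?z ** ?y)) = - \<tau> (K ** ?z ** ?y ** ?x)"
      by (rule rot[OF X])
    ultimately show ?thesis
      unfolding form_density_deriv_def Let_def P_def[symmetric] 1 2 by simp
  qed
  show ?thesis
    by (simp add: expand A B C)
qed

end

section \<open>Coordinates on the manifold\<close>

locale closed_manifold =
  fixes atlas :: "('m::{t2_space, second_countable_topology}, 'd::finite) chart set"
  assumes closed_oriented: "closed_oriented_manifold atlas"
begin

abbreviation chart_around :: "'m \<Rightarrow> ('m, 'd) chart \<Rightarrow> bool" where
  "chart_around p c \<equiv> c \<in> atlas \<and> p \<in> chart_dom c"

lemma chart_around_exists: "\<exists>c. chart_around p c"
  using closed_oriented unfolding closed_oriented_manifold_def by blast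

lemma chart_homeomorphism:
  assumes "c \<in> atlas"
  shows "open (chart_dom c)" "open (chart_im c)"
    "homeomorphism (chart_dom c) (chart_im c) (snd c) (chart_inv c)"
  using closed_oriented assms unfolding closed_oriented_manifold_def is_chart_def by auto

lemma chart_inv_chart:
  assumes "chart_around p c"
  shows "chart_inv c (snd c p) = p"
  using chart_homeomorphism[of c] assms by (auto simp: homeomorphism_def)

lemma open_chart_image:
  assumes "c \<in> atlas" "open U" "U \<subseteq> chart_dom c"
  shows "open (snd c ` U)"
proof -
  have "openin (top_of_set (chart_im c)) (snd c ` U)"
    using assms chart_homeomorphism[OF assms(1)]
    by (intro homeomorphism_imp_open_map[OF chart_homeomorphism(3)]) (auto simp: openin_open_eq)
  then show ?thesis
    using chart_homeomorphism(2)[OF assms(1)] by (simp add: openin_open_eq)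
qed

lemma transition_apply:
  assumes "chart_around p c"
  shows "transition c d (snd c p) = snd d p"
  using chart_inv_chart[OF assms] by (simp add: transition_def)

lemma transition_has_derivative:
  assumes "chart_around p c" "chart_around p d"
  shows "(transition c d has_derivative transition_deriv c d p) (at (snd c p))"
proof -
  have "Ck_on (Suc 0) (snd c ` (chart_dom c \<inter> chart_dom d)) (transition c d)"
    using closed_oriented assms unfolding closed_oriented_manifold_def smooth_on_def by blast
  then have "transition c d differentiable (at (snd c p))"
    using assms by auto
  then show ?thesis
    unfolding transition_deriv_def using frechet_derivative_works by blast
qed

lemma bounded_linear_transition_deriv:
  assumes "chart_around p c" "chart_around p d"
  shows "bounded_linear (transition_deriv c d p)"
  using transition_has_derivative[OF assms] by (rule has_derivative_bounded_linear)

text \<open>The chain rule, valid because both sides are derivatives of maps that agree on the open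
  image of a chart overlap. This cocycle identity is exactly the transformation law that makes
  \<open>tvec_of\<close> a tangent vector.\<close>

lemma transition_deriv_compose:
  assumes c: "chart_around p c" and d: "chart_around p d" and e: "chart_around p e"
  shows "transition_deriv d e p (transition_deriv c d p x) = transition_deriv c e p x"
proof -
  have "(transition d e has_derivative transition_deriv d e p) (at (transition c d (snd c p)))"
    using transition_has_derivative[OF d e] transition_apply[OF c] by simp
  from diff_chain_at[OF transition_has_derivative[OF c d] this]
  have 1: "(transition d e \<circ> transition c d has_derivative transition_deriv d e p \<circ> transition_deriv c d p)
      (at (snd c p))" .
  have "(transition c e has_derivative transition_deriv d e p \<circ> transition_deriv c d p) (at (snd c p))"
  proof (rule has_derivative_transform_within_open[OF 1])
    show "open (snd c ` (chart_dom c \<inter> chart_dom d))"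
      using c d by (intro open_chart_image open_Int chart_homeomorphism(1)) auto
    show "snd c p \<in> snd c ` (chart_dom c \<inter> chart_dom d)"
      using c d by auto
    fix x assume "x \<in> snd c ` (chart_dom c \<inter> chart_dom d)"
    then obtain q where "q \<in> chart_dom c" "q \<in> chart_dom d" "x = snd c q" by auto
    then show "(transition d e \<circ> transition c d) x = transition c e x"
      using transition_apply[where p = q and c = c] transition_apply[where p = q and c = d] c d by simp
  qed
  from has_derivative_unique[OF this transition_has_derivative[OF c e]]
  show ?thesis by (simp add: fun_eq_iff)
qed

lemma transition_deriv_self:
  assumes c: "chart_around p c"
  shows "transition_deriv c c p x = x"
proof -
  have "((\<lambda>x. x) has_derivative transition_deriv c c p) (at (snd c p))"
  proof (rule has_derivative_transform_within_open[OF transition_has_derivative[OF c c]])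
    show "open (chart_im c)" "snd c p \<in> chart_im c"
      using c chart_homeomorphism by auto
    show "transition c c x = x" if "x \<in> chart_im c" for x
      using that transition_apply[where c = c and d = c] c by auto
  qed
  from has_derivative_unique[OF this has_derivative_ident] show ?thesis by metis
qed

section \<open>Tangent vectors and endomorphisms in the coordinates of one chart\<close>

abbreviation tangent :: "'m \<Rightarrow> ('m, 'd) tvec set" where
  "tangent \<equiv> tangent_space atlas"

lemma tvec_of_in_tangent:
  assumes c: "chart_around p c"
  shows "tvec_of atlas c p x \<in> tangent p"
  unfolding tangent_space_def tvec_of_def
  using transition_deriv_compose[OF c] by auto

lemma tvec_of_same_chart:
  assumes c: "chart_around p c"
  shows "tvec_of atlas c p x c = x"
  using transition_deriv_self[OF c] c by (simp add: tvec_of_def)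

text \<open>Together with \<open>tvec_of_same_chart\<close> this identifies the tangent space with
  coordinate space. Outside the charts around \<open>p\<close> both sides are 0 by convention, which
  is why equality of functions can be concluded.\<close>

lemma tvec_of_component:
  assumes c: "chart_around p c" and v: "v \<in> tangent p"
  shows "tvec_of atlas c p (v c) = v"
proof
  fix d
  show "tvec_of atlas c p (v c) d = v d"
  proof (cases "chart_around p d")
    case True
    then have "v d = transition_deriv c d p (v c)"
      using c v unfolding tangent_space_def by blast
    with True show ?thesis by (simp add: tvec_of_def)
  next
    case False
    then have "v d = 0"
      using v unfolding tangent_space_def by blast
    with False show ?thesis by (auto simp: tvec_of_def)
  qed
qed

lemma tangent_eqI:
  assumes "chart_around p c" "v \<in> tangent p" "w \<in> tangent p" "v c = w c"
  shows "v = w"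
  using tvec_of_component assms by metis

lemma bounded_linear_tvec_of:
  assumes c: "chart_around p c"
  shows "bounded_linear (\<lambda>x. tvec_of atlas c p x e)"
  using bounded_linear_transition_deriv[OF c, of e] by (cases "chart_around p e") (auto simp: tvec_of_def)

lemma tvec_of_lincomb:
  assumes c: "chart_around p c"
  shows "tvec_of atlas c p (r *\<^sub>R x + s *\<^sub>R y) = lincomb r (tvec_of atlas c p x) s (tvec_of atlas c p y)"
  using linear_simps[OF bounded_linear_tvec_of[OF c]] by (auto simp: lincomb_def fun_eq_iff)

lemma lincomb_in_tangent:
  assumes "v \<in> tangent p" "w \<in> tangent p"
  shows "lincomb r v s w \<in> tangent p"
proof -
  obtain c where c: "chart_around p c" using chart_around_exists by blast
  have "lincomb r v s w = tvec_of atlas c p (r *\<^sub>R v c + s *\<^sub>R w c)"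
    by (simp only: tvec_of_lincomb[OF c] tvec_of_component[OF c assms(1)] tvec_of_component[OF c assms(2)])
  then show ?thesis by (simp only: tvec_of_in_tangent[OF c])
qed

text \<open>\<open>is_endo\<close> provides linearity on tangent vectors only. That suffices for
  \<open>matrix\<close> to represent the map, because \<open>tvec_of\<close> takes values in the
  tangent space and is linear in the coordinate vector.\<close>

lemma endo_matrix_works:
  assumes c: "chart_around p c" and L: "is_endo atlas p L" and v: "v \<in> tangent p"
  shows "L v c = endo_matrix atlas c p L *v v c"
proof -
  have lin: "L (tvec_of atlas c p (r *\<^sub>R x + s *\<^sub>R y)) c =
      r *\<^sub>R L (tvec_of atlas c p x) c + s *\<^sub>R L (tvec_of atlas c p y) c" for r s x y
    using L tvec_of_in_tangent[OF c] unfolding tvec_of_lincomb[OF c] is_endo_def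
    by (simp add: lincomb_def)
  have "linear (\<lambda>x. L (tvec_of atlas c p x) c)"
    using lin[of 1 _ 1] lin[of _ _ 0] by (intro linearI) simp_all
  then have "endo_matrix atlas c p L *v v c = L (tvec_of atlas c p (v c)) c"
    unfolding endo_matrix_def by (rule matrix_vector_mul(2)[THEN fun_cong])
  then show ?thesis
    using tvec_of_component[OF c v] by simp
qed

lemma endo_matrix_eqI:
  assumes "\<And>x. L (tvec_of atlas c p x) c = X *v x"
  shows "endo_matrix atlas c p L = X"
  unfolding endo_matrix_def assms by simp

lemma endo_matrix_compose:
  assumes c: "chart_around p c" and L: "is_endo atlas p L" and N: "is_endo atlas p N"
  shows "endo_matrix atlas c p (L \<circ> N) = endo_matrix atlas c p L ** endo_matrix atlas c p N"
proof (rule endo_matrix_eqI)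
  fix x
  have "N (tvec_of atlas c p x) \<in> tangent p"
    using N tvec_of_in_tangent[OF c] by (auto simp: is_endo_def)
  then show "(L \<circ> N) (tvec_of atlas c p x) c = endo_matrix atlas c p L ** endo_matrix atlas c p N *v x"
    using endo_matrix_works[OF c L] endo_matrix_works[OF c N tvec_of_in_tangent[OF c]]
    by (simp add: tvec_of_same_chart[OF c] matrix_vector_mul_assoc)
qed

lemma is_endo_compose:
  "is_endo atlas p L \<Longrightarrow> is_endo atlas p N \<Longrightarrow> is_endo atlas p (L \<circ> N)"
  by (auto simp: is_endo_def)

lemma endo_matrix_lincomb:
  assumes c: "chart_around p c" and L: "is_endo atlas p L" and N: "is_endo atlas p N"
  shows "endo_matrix atlas c p (\<lambda>v. lincomb r (L v) s (N v)) =
    r *\<^sub>R endo_matrix atlas c p L + s *\<^sub>R endo_matrix atlas c p N"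
  by (rule endo_matrix_eqI)
    (simp only: lincomb_def tvec_of_same_chart[OF c] matrix_vector_mult_add_rdistrib scaleR_matrix_vector_assoc
      endo_matrix_works[OF c L tvec_of_in_tangent[OF c]] endo_matrix_works[OF c N tvec_of_in_tangent[OF c]])

lemma is_endo_lincomb:
  assumes L: "is_endo atlas p L" and N: "is_endo atlas p N"
  shows "is_endo atlas p (\<lambda>v. lincomb r (L v) s (N v))"
proof -
  have "lincomb r (lincomb r' (L v) s' (L w)) s (lincomb r' (N v) s' (N w)) =
    lincomb r' (lincomb r (L v) s (N v)) s' (lincomb r (L w) s (N w))" for r' s' v w
    by (simp add: lincomb_def fun_eq_iff algebra_simps)
  then show ?thesis
    using L N lincomb_in_tangent by (simp add: is_endo_def)
qed

text \<open>This serves to recognize \<open>acs_param\<close> and \<open>acs_param_deriv\<close> as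
  endomorphisms and to read off their matrices. It prescribes \<open>L\<close> on tangent vectors
  only, since the two fields are controlled only there.\<close>

lemma endo_of_matrix:
  assumes c: "chart_around p c" and L: "\<And>v. v \<in> tangent p \<Longrightarrow> L v = tvec_of atlas c p (X *v v c)"
  shows "is_endo atlas p L" "endo_matrix atlas c p L = X"
proof -
  have "L (lincomb r v s w) = lincomb r (L v) s (L w)" if "v \<in> tangent p" "w \<in> tangent p" for r v s w
  proof -
    have "L (lincomb r v s w) = tvec_of atlas c p (r *\<^sub>R (X *v v c) + s *\<^sub>R (X *v w c))"
      using L[OF lincomb_in_tangent[OF that]]
      by (simp add: lincomb_def matrix_vector_right_distrib matrix_vector_mult_scaleR)
    then show ?thesis
      using tvec_of_lincomb[OF c] L that by simp
  qed
  then show "is_endo atlas p L"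
    using L tvec_of_in_tangent[OF c] by (simp add: is_endo_def)
  show "endo_matrix atlas c p L = X"
    using L tvec_of_in_tangent[OF c] tvec_of_same_chart[OF c] by (intro endo_matrix_eqI) simp
qed

text \<open>The two matrices are conjugate by the Jacobian \<open>T\<close> of the transition map,
  whose inverse is the Jacobian \<open>T'\<close> of the reverse transition.\<close>

lemma trace_endo_matrix_eq:
  assumes c: "chart_around p c" and d: "chart_around p d" and L: "is_endo atlas p L"
  shows "trace (endo_matrix atlas c p L) = trace (endo_matrix atlas d p L)"
proof -
  define T where "T = matrix (transition_deriv c d p)"
  define T' where "T' = matrix (transition_deriv d c p)"
  have T: "T *v x = transition_deriv c d p x" and T': "T' *v x = transition_deriv d c p x" for x
    unfolding T_def T'_def
    by (rule matrix_vector_mul(3)[THEN fun_cong, OF bounded_linear_transition_deriv[OF c d]],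
        rule matrix_vector_mul(3)[THEN fun_cong, OF bounded_linear_transition_deriv[OF d c]])
  have T'T: "T' ** T = mat 1"
    using transition_deriv_compose[OF c d c] transition_deriv_self[OF c]
    by (simp add: matrix_eq T T' matrix_vector_mul_assoc[symmetric])
  have "endo_matrix atlas d p L = T ** endo_matrix atlas c p L ** T'"
  proof (rule endo_matrix_eqI)
    fix x
    let ?v = "tvec_of atlas d p x"
    have v: "?v \<in> tangent p" using tvec_of_in_tangent[OF d] .
    then have "L ?v \<in> tangent p" using L by (auto simp: is_endo_def)
    then have "L ?v d = transition_deriv c d p (L ?v c)"
      using c d by (auto simp: tangent_space_def)
    also have "\<dots> = transition_deriv c d p (endo_matrix atlas c p L *v ?v c)"
      by (simp add: endo_matrix_works[OF c L v])
    also have "?v c = transition_deriv d c p x"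
      using c by (simp add: tvec_of_def)
    finally show "L ?v d = T ** endo_matrix atlas c p L ** T' *v x"
      by (simp add: matrix_vector_mul_assoc[symmetric] T T')
  qed
  then have "trace (endo_matrix atlas d p L) = trace (T' ** (T ** endo_matrix atlas c p L))"
    by (simp only: trace_mul_sym[of _ T'])
  then show ?thesis
    by (simp add: matrix_mul_assoc T'T)
qed

lemma endo_trace_eq:
  assumes c: "chart_around p c" and L: "is_endo atlas p L"
  shows "endo_trace atlas p L = trace (endo_matrix atlas c p L)"
  unfolding endo_trace_def
  by (rule trace_endo_matrix_eq[OF someI_ex[OF chart_around_exists] c L])

text \<open>The coordinate map carries 1 - L to multiplication by its matrix. The left-hand side
  mentions no chart, so the equivalence also shows that invertibility of the matrix does not depend
  on the chart.\<close>

lemma bij_one_minus_iff: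
  assumes c: "chart_around p c" and L: "is_endo atlas p L"
  shows "bij_betw (\<lambda>v. lincomb 1 v (-1) (L v)) (tangent p) (tangent p) \<longleftrightarrow>
    invertible (mat 1 - endo_matrix atlas c p L)" (is "bij_betw ?f _ _ \<longleftrightarrow> invertible ?Q")
proof -
  have L_in: "L v \<in> tangent p" if "v \<in> tangent p" for v
    using L that by (auto simp: is_endo_def)
  have comp: "?f v c = ?Q *v v c" if "v \<in> tangent p" for v
    using endo_matrix_works[OF c L that] by (simp add: lincomb_def matrix_vector_mult_diff_rdistrib)
  have f_in: "?f v \<in> tangent p" if "v \<in> tangent p" for v
    using lincomb_in_tangent L_in that by blast
  show ?thesis
  proof
    assume bij: "bij_betw ?f (tangent p) (tangent p)"
    have "inj ((*v) ?Q)"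
    proof (rule injI)
      fix x y assume "?Q *v x = ?Q *v y"
      then have "?f (tvec_of atlas c p x) c = ?f (tvec_of atlas c p y) c"
        using comp tvec_of_in_tangent[OF c] tvec_of_same_chart[OF c] by simp
      then have "?f (tvec_of atlas c p x) = ?f (tvec_of atlas c p y)"
        using tangent_eqI[OF c] f_in tvec_of_in_tangent[OF c] by blast
      then have "tvec_of atlas c p x = tvec_of atlas c p y"
        using bij tvec_of_in_tangent[OF c] by (auto simp: bij_betw_def inj_on_def)
      then show "x = y" using tvec_of_same_chart[OF c] by metis
    qed
    then show "invertible ?Q"
      using matrix_left_invertible_injective invertible_left_inverse by blast
  next
    assume inv: "invertible ?Q"
    show "bij_betw ?f (tangent p) (tangent p)"
    proof (rule bij_betw_byWitness[where f' = "\<lambda>v. tvec_of atlas c p (matrix_inv ?Q *v v c)"])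
      show "\<forall>v\<in>tangent p. tvec_of atlas c p (matrix_inv ?Q *v ?f v c) = v"
        using matrix_inv_inverse[OF inv]
        by (simp add: comp matrix_vector_mul_assoc tvec_of_component[OF c])
      show "\<forall>v\<in>tangent p. ?f (tvec_of atlas c p (matrix_inv ?Q *v v c)) = v"
      proof
        fix v assume v: "v \<in> tangent p"
        let ?w = "tvec_of atlas c p (matrix_inv ?Q *v v c)"
        have "?f ?w c = v c"
          using matrix_inv_inverse[OF inv]
          by (simp add: comp tvec_of_in_tangent[OF c] tvec_of_same_chart[OF c] matrix_vector_mul_assoc)
        then show "?f ?w = v"
          using tangent_eqI[OF c] f_in tvec_of_in_tangent[OF c] v by blast
      qed
    qed (use f_in tvec_of_in_tangent[OF c] in auto)
  qed
qed

section \<open>The Cayley parametrization and its differential in coordinates\<close>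

lemma acs_param_eq:
  fixes J K
  assumes c: "chart_around p c" and J: "is_endo atlas p (J p)" and K: "is_endo atlas p (K p)"
    and inv: "invertible (mat 1 - endo_matrix atlas c p (K p))" and v: "v \<in> tangent p"
  shows "acs_param atlas J K p v =
    tvec_of atlas c p (endo_matrix atlas c p (J p) ** (mat 1 + endo_matrix atlas c p (K p)) **
      matrix_inv (mat 1 - endo_matrix atlas c p (K p)) *v v c)"
proof -
  let ?R = "matrix_inv (mat 1 - endo_matrix atlas c p (K p))"
  let ?f = "\<lambda>v. lincomb 1 v (-1) (K p v)"
  have K_in: "K p v \<in> tangent p" if "v \<in> tangent p" for v
    using K that by (auto simp: is_endo_def)
  \<comment> \<open>The candidate for the preimage of \<open>v\<close> under 1 - K; injectivity then
    forces \<open>inv_into\<close> in \<open>acs_param\<close> to return it.\<close>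
  define w where "w = tvec_of atlas c p (?R *v v c)"
  have w: "w \<in> tangent p" "w c = ?R *v v c"
    using tvec_of_in_tangent[OF c] tvec_of_same_chart[OF c] by (simp_all add: w_def)
  have "?f w c = (mat 1 - endo_matrix atlas c p (K p)) *v w c"
    using endo_matrix_works[OF c K w(1)] by (simp add: lincomb_def matrix_vector_mult_diff_rdistrib)
  also have "\<dots> = v c"
    unfolding w(2) matrix_vector_mul_assoc matrix_inv_inverse[OF inv] by simp
  finally have "?f w c = v c" .
  then have "?f w = v"
    using tangent_eqI[OF c] lincomb_in_tangent K_in w v by blast
  moreover have "inj_on ?f (tangent p)"
    using bij_one_minus_iff[OF c K] inv by (simp add: bij_betw_def)
  ultimately have inv_into: "inv_into (tangent p) ?f v = w"
    using inv_into_f_eq[where f = ?f and A = "tangent p" and x = w and y = v] w(1) by simp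
  have u: "lincomb 1 w 1 (K p w) \<in> tangent p"
    using lincomb_in_tangent K_in w by blast
  have "J p (lincomb 1 w 1 (K p w)) c = endo_matrix atlas c p (J p) ** (mat 1 + endo_matrix atlas c p (K p)) ** ?R *v v c"
    using endo_matrix_works[OF c J u] endo_matrix_works[OF c K w(1)] w(2)
    by (simp add: lincomb_def matrix_vector_mult_add_rdistrib flip: matrix_vector_mul_assoc)
  moreover have "J p (lincomb 1 w 1 (K p w)) \<in> tangent p"
    using J u by (auto simp: is_endo_def)
  ultimately have "J p (lincomb 1 w 1 (K p w)) = tvec_of atlas c p
      (endo_matrix atlas c p (J p) ** (mat 1 + endo_matrix atlas c p (K p)) ** ?R *v v c)"
    using tvec_of_component[OF c] by metis
  then show ?thesis
    by (simp add: acs_param_def Let_def inv_into)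
qed

text \<open>\<open>acs_param_deriv\<close> differentiates every chart component \<open>e\<close>
  separately. Each of them is a fixed linear function of the matrix in the chart \<open>c\<close>,
  so the derivative of the matrix curve determines them all, including the zero components.\<close>

lemma acs_param_deriv_eq:
  fixes J K A
  assumes c: "chart_around p c" and J: "is_endo atlas p (J p)" and K: "is_endo atlas p (K p)"
    and A: "is_endo atlas p (A p)"
    and inv: "invertible (mat 1 - endo_matrix atlas c p (K p))" and v: "v \<in> tangent p"
  defines "R \<equiv> matrix_inv (mat 1 - endo_matrix atlas c p (K p))"
  shows "acs_param_deriv atlas J K A p v =
    tvec_of atlas c p ((2 *\<^sub>R (endo_matrix atlas c p (J p) ** R ** endo_matrix atlas c p (A p) ** R)) *v v c)"
proof
  fix e
  let ?J = "endo_matrix atlas c p (J p)" and ?K = "endo_matrix atlas c p (K p)" and ?A = "endo_matrix atlas c p (A p)"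
  let ?Y = "\<lambda>t. ?J ** (mat 1 + (?K + t *\<^sub>R ?A)) ** matrix_inv (mat 1 - (?K + t *\<^sub>R ?A))"
  have Kt: "endo_matrix atlas c p (field_lincomb 1 K t A p) = ?K + t *\<^sub>R ?A"
    "is_endo atlas p (field_lincomb 1 K t A p)" for t
    using endo_matrix_lincomb[OF c K A, of 1 t] is_endo_lincomb[OF K A, of 1 t]
    by (simp_all add: field_lincomb_def)
  have bl: "bounded_linear (\<lambda>X. tvec_of atlas c p (X *v v c) e)"
    by (intro bounded_linear_compose[OF bounded_linear_tvec_of[OF c]])
      (auto simp: linear_conv_bounded_linear[symmetric] matrix_vector_mult_add_rdistrib scaleR_matrix_vector_assoc intro!: linearI)
  have der: "((\<lambda>t. tvec_of atlas c p (?Y t *v v c) e) has_vector_derivative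
      tvec_of atlas c p ((2 *\<^sub>R (?J ** R ** ?A ** R)) *v v c) e) (at 0)"
    unfolding R_def by (rule bounded_linear.has_vector_derivative[OF bl cayley_has_vector_derivative[OF inv]])
  \<comment> \<open>The coordinate formula for \<open>acs_param\<close> requires 1 - (K + t A) to be
    invertible; \<open>U\<close> is an open set of such t around 0, enough for a derivative at
    0.\<close>
  define U where "U = (\<lambda>t. mat 1 - (?K + t *\<^sub>R ?A)) -` {X. invertible X}"
  have "open U"
    unfolding U_def by (intro open_vimage open_invertible continuous_intros)
  moreover have "0 \<in> U" using inv by (simp add: U_def)
  moreover have "tvec_of atlas c p (?Y t *v v c) e = acs_param atlas J (field_lincomb 1 K t A) p v e"
    if "t \<in> U" for t
    using that by (subst acs_param_eq[where J = J and K = "field_lincomb 1 K t A", OF c J Kt(2) _ v]) (simp_all add: Kt(1) U_def)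
  ultimately have "((\<lambda>t. acs_param atlas J (field_lincomb 1 K t A) p v e) has_vector_derivative
      tvec_of atlas c p ((2 *\<^sub>R (?J ** R ** ?A ** R)) *v v c) e) (at 0)"
    by (rule has_vector_derivative_transform_within_open[OF der])
  then show "acs_param_deriv atlas J K A p v e =
      tvec_of atlas c p ((2 *\<^sub>R (?J ** R ** ?A ** R)) *v v c) e"
    by (simp add: acs_param_deriv_def vector_derivative_at)
qed

end

section \<open>Integration over the manifold\<close>

text \<open>The mean value inequality bounds all difference quotients by \<open>b\<close>, and a
  constant is integrable for a finite measure, so dominated convergence applies along every sequence
  tending to 0.\<close>

lemma has_real_derivative_integral:
  fixes f f' :: "real \<Rightarrow> 'a \<Rightarrow> real"
  assumes fin: "finite_measure M" and \<delta>: "\<delta> > 0"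
    and int: "\<And>t. \<bar>t\<bar> \<le> \<delta> \<Longrightarrow> integrable M (f t)"
    and der: "\<And>t x. \<bar>t\<bar> \<le> \<delta> \<Longrightarrow> x \<in> space M \<Longrightarrow> ((\<lambda>s. f s x) has_real_derivative f' t x) (at t)"
    and bound: "\<And>t x. \<bar>t\<bar> \<le> \<delta> \<Longrightarrow> x \<in> space M \<Longrightarrow> \<bar>f' t x\<bar> \<le> b"
  shows "integrable M (f' 0)"
    and "((\<lambda>t. \<integral>x. f t x \<partial>M) has_real_derivative (\<integral>x. f' 0 x \<partial>M)) (at 0)"
proof -
  interpret finite_measure M by (rule fin)
  define q where "q t x = (f t x - f 0 x) / t" for t x
  have q_bound: "\<bar>q t x\<bar> \<le> b" if t: "\<bar>t\<bar> \<le> \<delta>" "t \<noteq> 0" and x: "x \<in> space M" for t x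
  proof -
    have "norm (f t x - f 0 x) \<le> b * norm (t - 0)"
    proof (rule field_differentiable_bound[where S = "{- \<delta>..\<delta>}" and f = "\<lambda>s. f s x" and f' = "\<lambda>s. f' s x"])
      show "((\<lambda>s. f s x) has_real_derivative f' z x) (at z within {- \<delta>..\<delta>})" if z: "z \<in> {- \<delta>..\<delta>}" for z
        by (rule has_field_derivative_at_within, rule der) (use z x in auto)
      show "norm (f' z x) \<le> b" if "z \<in> {- \<delta>..\<delta>}" for z
        using bound[of z x] that x by auto
    qed (use t \<delta> in auto)
    then show ?thesis using t by (simp add: q_def field_simps)
  qed
  have q_int: "integrable M (q t)" if "\<bar>t\<bar> \<le> \<delta>" for t
    unfolding q_def using int[OF that] int[of 0] \<delta> by auto
  have q_lim: "(\<lambda>n. q (s n) x) \<longlonglongrightarrow> f' 0 x"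
    if "s \<longlonglongrightarrow> 0" "\<And>n. s n \<noteq> 0" "x \<in> space M" for s x
  proof -
    have "((\<lambda>t. q t x) \<longlongrightarrow> f' 0 x) (at 0)"
      using der[of 0 x] that(3) \<delta> by (simp add: has_field_derivative_iff q_def)
    then show ?thesis
      using that by (auto simp: tendsto_at_iff_sequentially comp_def)
  qed
  \<comment> \<open>Measurability of \<open>f' 0\<close> is not among the assumptions; it comes from
    the difference quotients at the times \<open>\<delta> / (n + 1)\<close>, which are integrable
    and converge to it pointwise.\<close>
  have meas: "f' 0 \<in> borel_measurable M"
  proof (rule borel_measurable_LIMSEQ_real)
    show "(\<lambda>n. q (\<delta> / real (Suc n)) x) \<longlonglongrightarrow> f' 0 x" if "x \<in> space M" for x
      using that \<delta> LIMSEQ_Suc[OF lim_const_over_n[of \<delta>]] by (intro q_lim) auto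
    show "q (\<delta> / real (Suc n)) \<in> borel_measurable M" for n
      using \<delta> by (intro borel_measurable_integrable q_int) (simp add: field_simps)
  qed
  show f'_int: "integrable M (f' 0)"
    using meas bound[of 0] \<delta> by (intro integrable_const_bound[where B = b]) auto
  have lim: "(\<lambda>n. \<integral>x. q (s n) x \<partial>M) \<longlonglongrightarrow> (\<integral>x. f' 0 x \<partial>M)"
    if "s \<longlonglongrightarrow> 0" "\<And>n. s n \<noteq> 0" "\<And>n. \<bar>s n\<bar> \<le> \<delta>" for s
    using that q_int q_lim q_bound meas
    by (intro integral_dominated_convergence[where w = "\<lambda>_. b"]) auto
  show "((\<lambda>t. \<integral>x. f t x \<partial>M) has_real_derivative (\<integral>x. f' 0 x \<partial>M)) (at 0)"
    unfolding has_field_derivative_iff tendsto_at_iff_sequentially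
  proof (intro allI impI)
    fix s :: "nat \<Rightarrow> real"
    assume s: "\<forall>i. s i \<in> UNIV - {0}" "s \<longlonglongrightarrow> 0"
    \<comment> \<open>The bounds hold only for times within \<open>\<delta>\<close>, so an initial
      segment of the sequence is dropped.\<close>
    obtain N where N: "\<And>n. n \<ge> N \<Longrightarrow> \<bar>s n\<bar> \<le> \<delta>"
      using s(2) \<delta> unfolding lim_sequentially dist_real_def by (metis diff_zero less_imp_le)
    have "(\<lambda>n. \<integral>x. q (s (n + N)) x \<partial>M) \<longlonglongrightarrow> (\<integral>x. f' 0 x \<partial>M)"
      using s N LIMSEQ_ignore_initial_segment[OF s(2), of N] by (intro lim) auto
    then have "(\<lambda>n. ((\<integral>x. f (s (n + N)) x \<partial>M) - (\<integral>x. f 0 x \<partial>M)) / (s (n + N) - 0)) \<longlonglongrightarrow> (\<integral>x. f' 0 x \<partial>M)"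
      using int N \<delta> by (simp add: q_def)
    then show "((\<lambda>t. ((\<integral>x. f t x \<partial>M) - (\<integral>x. f 0 x \<partial>M)) / (t - 0)) \<circ> s) \<longlonglongrightarrow> (\<integral>x. f' 0 x \<partial>M)"
      unfolding comp_def by (rule LIMSEQ_offset)
  qed
qed

context closed_manifold
begin

text \<open>A chart around every point, chosen so that the points assigned to one chart lie in finitely many
  compact subsets of its domain; continuous local expressions then take values in one compact set.\<close>

definition tame_selection :: "('m \<Rightarrow> ('m, 'd) chart) \<Rightarrow> bool" where
  "tame_selection cp \<longleftrightarrow> (\<exists>F. finite F \<and>
     (\<forall>c N. (c, N) \<in> F \<longrightarrow> c \<in> atlas \<and> compact N \<and> N \<subseteq> chart_dom c) \<and> (\<forall>p. \<exists>N. (cp p, N) \<in> F \<and> p \<in> N))"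

lemma tame_selectionE:
  assumes "tame_selection cp"
  obtains F where "finite F" "\<And>c N. (c, N) \<in> F \<Longrightarrow> c \<in> atlas \<and> compact N \<and> N \<subseteq> chart_dom c"
    "\<And>p. \<exists>N. (cp p, N) \<in> F \<and> p \<in> N"
  using assms unfolding tame_selection_def by blast

lemma tame_selection_around:
  assumes "tame_selection cp"
  shows "chart_around p (cp p)"
  using assms by (rule tame_selectionE) blast

text \<open>A closed coordinate ball inside the open chart image is pulled back to \<open>N\<close>,
  and the concentric open ball to \<open>U\<close>.\<close>

lemma compact_chart_neighbourhood:
  obtains c N U where "c \<in> atlas" "compact N" "N \<subseteq> chart_dom c" "open U" "p \<in> U" "U \<subseteq> N"
proof -
  obtain c where c: "chart_around p c" using chart_around_exists by blast
  note h = chart_homeomorphism[OF conjunct1[OF c]]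
  obtain e where e: "e > 0" "cball (snd c p) e \<subseteq> chart_im c"
    using h(2) c unfolding open_contains_cball by blast
  have cont: "continuous_on (chart_dom c) (snd c)" "continuous_on (chart_im c) (chart_inv c)"
    using h(3) by (auto simp: homeomorphism_def)
  show thesis
  proof
    show "c \<in> atlas" using c by simp
    show "compact (chart_inv c ` cball (snd c p) e)"
      using cont(2) e(2) by (intro compact_continuous_image) (auto intro: continuous_on_subset)
    show "chart_inv c ` cball (snd c p) e \<subseteq> chart_dom c"
      using h(3) e(2) by (force simp: homeomorphism_def)
    show "open (chart_dom c \<inter> snd c -` ball (snd c p) e)"
      using cont(1) h(1) by (intro continuous_open_preimage) auto
    show "p \<in> chart_dom c \<inter> snd c -` ball (snd c p) e"
      using c e(1) by simp
    show "chart_dom c \<inter> snd c -` ball (snd c p) e \<subseteq> chart_inv c ` cball (snd c p) e"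
    proof
      fix q assume q: "q \<in> chart_dom c \<inter> snd c -` ball (snd c p) e"
      then have "q = chart_inv c (snd c q)"
        using chart_inv_chart[where p = q and c = c] c by simp
      then show "q \<in> chart_inv c ` cball (snd c p) e"
        using q by (intro image_eqI[where x = "snd c q"]) auto
    qed
  qed
qed

text \<open>Compactness leaves finitely many of the neighbourhoods \<open>U\<close>, and every point
  picks one of the finitely many sets \<open>N\<close> that contains it.\<close>

lemma tame_selection_exists: "\<exists>cp. tame_selection cp"
proof -
  \<comment> \<open>The triples (c, N, U) are packed into a single value so that one choice function
    \<open>X\<close> delivers all three.\<close>
  define good where "good p x \<longleftrightarrow> fst x \<in> atlas \<and> compact (fst (snd x)) \<and> fst (snd x) \<subseteq> chart_dom (fst x) \<and>
      open (snd (snd x)) \<and> p \<in> snd (snd x) \<and> snd (snd x) \<subseteq> fst (snd x)"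
    for p and x :: "('m, 'd) chart \<times> 'm set \<times> 'm set"
  have "\<exists>x. good p x" for p
  proof -
    obtain c N U where "c \<in> atlas" "compact N" "N \<subseteq> chart_dom c" "open U" "p \<in> U" "U \<subseteq> N"
      by (rule compact_chart_neighbourhood)
    then have "good p (c, N, U)" by (simp add: good_def)
    then show ?thesis ..
  qed
  then obtain X where good: "\<And>p. good p (X p)"
    by metis
  have X: "fst (X p) \<in> atlas" "compact (fst (snd (X p)))"
    "fst (snd (X p)) \<subseteq> chart_dom (fst (X p))" "open (snd (snd (X p)))"
    "p \<in> snd (snd (X p))" "snd (snd (X p)) \<subseteq> fst (snd (X p))" for p
    using good[of p] by (simp_all add: good_def)
  have "compact (UNIV :: 'm set)"
    using closed_oriented by (simp add: closed_oriented_manifold_def)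
  then obtain P where P: "finite P" "UNIV \<subseteq> (\<Union>p\<in>P. snd (snd (X p)))"
  proof (rule compactE_image)
    show "open (snd (snd (X p)))" for p by (rule X(4))
    show "UNIV \<subseteq> (\<Union>p\<in>UNIV. snd (snd (X p)))" using X(5) by blast
  qed blast
  have "\<forall>p. \<exists>q. q \<in> P \<and> p \<in> fst (snd (X q))"
    using P(2) X(6) by blast
  then obtain s where s: "\<And>p. s p \<in> P" "\<And>p. p \<in> fst (snd (X (s p)))"
    by metis
  have "tame_selection (\<lambda>p. fst (X (s p)))"
    unfolding tame_selection_def
  proof (intro exI[of _ "(\<lambda>q. (fst (X q), fst (snd (X q)))) ` P"] conjI allI impI)
    fix c N assume "(c, N) \<in> (\<lambda>q. (fst (X q), fst (snd (X q)))) ` P"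
    then obtain q where "c = fst (X q)" "N = fst (snd (X q))" by auto
    then show "c \<in> atlas" "compact N" "N \<subseteq> chart_dom c"
      using X(1-3) by simp_all
  next
    fix p
    show "\<exists>N. (fst (X (s p)), N) \<in> (\<lambda>q. (fst (X q), fst (snd (X q)))) ` P \<and> p \<in> N"
      using s by (intro exI[of _ "fst (snd (X (s p)))"]) simp
  qed (simp add: P(1))
  then show ?thesis by blast
qed

text \<open>\<open>S\<close> is the finite union of the images of the compact pieces. The last
  conclusion matters as much as compactness: a property known for \<open>f c p\<close> in every
  chart around \<open>p\<close>, such as invertibility, transfers to all of
  \<open>S\<close>.\<close>

lemma tame_selection_compact:
  fixes f :: "('m, 'd) chart \<Rightarrow> 'm \<Rightarrow> 'z::topological_space"
  assumes "tame_selection cp" and f: "\<And>c. c \<in> atlas \<Longrightarrow> continuous_on (chart_dom c) (f c)"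
  obtains S where "compact S" "\<And>p. f (cp p) p \<in> S"
    "\<And>z. z \<in> S \<Longrightarrow> \<exists>c p. chart_around p c \<and> z = f c p"
proof -
  obtain F where F: "finite F" "\<And>c N. (c, N) \<in> F \<Longrightarrow> c \<in> atlas \<and> compact N \<and> N \<subseteq> chart_dom c"
    "\<And>p. \<exists>N. (cp p, N) \<in> F \<and> p \<in> N"
    using assms(1) by (rule tame_selectionE) blast
  show thesis
  proof
    show "compact (\<Union>x\<in>F. f (fst x) ` snd x)"
    proof (rule compact_UN[OF F(1)])
      fix x assume "x \<in> F"
      then have "fst x \<in> atlas" "compact (snd x)" "snd x \<subseteq> chart_dom (fst x)"
        using F(2)[of "fst x" "snd x"] by auto
      then show "compact (f (fst x) ` snd x)"
        using continuous_on_subset[OF f] by (intro compact_continuous_image) blast+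
    qed
    show "f (cp p) p \<in> (\<Union>x\<in>F. f (fst x) ` snd x)" for p
      using F(3)[of p] by force
    show "\<exists>c p. chart_around p c \<and> z = f c p" if "z \<in> (\<Union>x\<in>F. f (fst x) ` snd x)" for z
      using that F(2) by fastforce
  qed
qed

lemma continuous_on_chartwise:
  fixes f :: "'m \<Rightarrow> 'z::topological_space"
  assumes "\<And>c. c \<in> atlas \<Longrightarrow> continuous_on (chart_dom c) f"
  shows "continuous_on UNIV f"
proof -
  have "continuous_on (\<Union>c\<in>atlas. chart_dom c) f"
    using assms chart_homeomorphism(1) by (intro continuous_on_open_UN) auto
  then show ?thesis
    using closed_oriented by (simp add: closed_oriented_manifold_def)
qed

lemma continuous_on_chart_dom:
  fixes f :: "'m \<Rightarrow> 'z::topological_space"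
  assumes c: "c \<in> atlas" and f: "continuous_on (chart_im c) (\<lambda>x. f (chart_inv c x))"
  shows "continuous_on (chart_dom c) f"
proof -
  have "continuous_on (chart_dom c) (\<lambda>p. f (chart_inv c (snd c p)))"
    using f chart_homeomorphism(3)[OF c]
    by (intro continuous_on_compose2[OF f]) (auto simp: homeomorphism_def)
  then show ?thesis
    by (rule continuous_on_eq) (use chart_inv_chart c in simp)
qed

end

section \<open>Finiteness of the Riemannian volume and integrability of continuous functions\<close>

locale closed_riemannian_manifold = closed_manifold atlas
  for atlas :: "('m::{t2_space, second_countable_topology}, 'd::finite) chart set" +
  fixes g :: "'m \<Rightarrow> ('m, 'd) tvec \<Rightarrow> ('m, 'd) tvec \<Rightarrow> real" and \<mu> :: "'m measure"
  assumes metric: "riemannian_metric atlas g" and volume: "is_riemannian_volume atlas g \<mu>"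
begin

lemma sets_volume: "sets \<mu> = sets borel"
  using volume by (simp add: is_riemannian_volume_def)

lemma space_volume: "space \<mu> = UNIV"
  using sets_eq_imp_space_eq[OF sets_volume] by simp

text \<open>The volume density is continuous, hence bounded on the compact coordinate image, which
  has finite Lebesgue measure.\<close>

lemma emeasure_compact_in_chart:
  assumes c: "c \<in> atlas" and N: "compact N" "N \<subseteq> chart_dom c"
  shows "emeasure \<mu> N < \<infinity>"
proof -
  define h where "h x = sqrt (det (gram_matrix atlas g c (chart_inv c x)))" for x
  have "continuous_on N (snd c)"
    using N(2) chart_homeomorphism(3)[OF c] by (intro continuous_on_subset[OF homeomorphism_cont1])
  then have im: "compact (snd c ` N)" "snd c ` N \<subseteq> chart_im c"
    using N by (auto intro: compact_continuous_image)
  have "Ck_on 0 (chart_im c) (\<lambda>x. gram_matrix atlas g c (chart_inv c x))"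
    using metric c unfolding riemannian_metric_def smooth_on_def by blast
  then have "continuous_on (chart_im c) h"
    unfolding h_def by (intro continuous_intros continuous_on_det) simp
  then have "bounded (h ` snd c ` N)"
    by (rule compact_imp_bounded[OF compact_continuous_image[OF continuous_on_subset[OF _ im(2)] im(1)]])
  then obtain b where "\<forall>y\<in>h ` snd c ` N. norm y \<le> b"
    unfolding bounded_iff by blast
  then have b: "h x \<le> b" if "x \<in> snd c ` N" for x
    using that by (auto dest!: bspec intro: abs_le_D1)
  have "N \<in> sets borel"
    by (rule borel_closed[OF compact_imp_closed[OF N(1)]])
  then have "emeasure \<mu> N = (\<integral>\<^sup>+x. ennreal (h x) * indicator (snd c ` N) x \<partial>lborel)"
    using volume c N(2) by (simp add: is_riemannian_volume_def h_def)
  also have "\<dots> \<le> (\<integral>\<^sup>+x. ennreal b * indicator (snd c ` N) x \<partial>lborel)"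
    by (intro nn_integral_mono) (simp add: indicator_def ennreal_leI b)
  also have "\<dots> = ennreal b * emeasure lborel (snd c ` N)"
    using im(1) by (intro nn_integral_cmult_indicator) (simp add: borel_compact)
  also have "\<dots> < \<infinity>"
    using emeasure_compact_finite[OF im(1)] by (simp add: ennreal_mult_less_top)
  finally show ?thesis .
qed

text \<open>The compact pieces of a tame selection are finitely many and cover the manifold, and
  each has finite volume.\<close>

lemma finite_measure_volume: "finite_measure \<mu>"
proof -
  obtain cp where "tame_selection cp" using tame_selection_exists by blast
  then obtain F where F: "finite F" "\<And>c N. (c, N) \<in> F \<Longrightarrow> c \<in> atlas \<and> compact N \<and> N \<subseteq> chart_dom c"
    "\<And>p. \<exists>N. (cp p, N) \<in> F \<and> p \<in> N"
    by (rule tame_selectionE) blast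
  have sets: "snd x \<in> sets \<mu>" if "x \<in> F" for x
    using F(2)[of "fst x" "snd x"] that sets_volume by (simp add: borel_closed compact_imp_closed)
  have "space \<mu> = (\<Union>x\<in>F. snd x)"
    using F(3) space_volume by force
  then have "emeasure \<mu> (space \<mu>) \<le> (\<Sum>x\<in>F. emeasure \<mu> (snd x))"
    using emeasure_subadditive_finite[of F snd \<mu>] F(1) image_subsetI[of F snd, OF sets] by simp
  also have "\<dots> < \<infinity>"
  proof -
    have "emeasure \<mu> (snd x) < \<infinity>" if "x \<in> F" for x
      using F(2)[of "fst x" "snd x"] that by (intro emeasure_compact_in_chart[of "fst x"]) auto
    then show ?thesis
      using F(1) by simp
  qed
  finally show ?thesis
    by (intro finite_measureI) auto
qed

sublocale finite_measure \<mu>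
  by (rule finite_measure_volume)

lemma integrable_continuous:
  fixes f :: "'m \<Rightarrow> real"
  assumes "continuous_on UNIV f"
  shows "integrable \<mu> f"
proof -
  have "compact (UNIV :: 'm set)"
    using closed_oriented by (simp add: closed_oriented_manifold_def)
  then have "bounded (range f)"
    using assms by (intro compact_imp_bounded compact_continuous_image)
  then obtain b where "\<And>x. norm (f x) \<le> b"
    unfolding bounded_iff by auto
  moreover have "f \<in> borel_measurable \<mu>"
    using borel_measurable_continuous_onI[OF assms] measurable_cong_sets[OF sets_volume refl] by blast
  ultimately show ?thesis
    by (intro integrable_const_bound[where B = b]) auto
qed

end

section \<open>The fundamental form\<close>

context closed_riemannian_manifold
begin

abbreviation field_matrix :: "('m, 'd) chart \<Rightarrow> ('m, 'd) endo_field \<Rightarrow> 'm \<Rightarrow> real^'d^'d" where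
  "field_matrix c K p \<equiv> endo_matrix atlas c p (K p)"

text \<open>The integrability and compactness arguments are phrased for this class, which the
  combinations K + t A visibly inherit from K and A.\<close>

definition continuous_endo_field :: "('m, 'd) endo_field \<Rightarrow> bool" where
  "continuous_endo_field K \<longleftrightarrow> (\<forall>p. is_endo atlas p (K p)) \<and>
     (\<forall>c\<in>atlas. continuous_on (chart_dom c) (field_matrix c K))"

lemma continuous_endo_fieldD:
  assumes "continuous_endo_field K"
  shows "is_endo atlas p (K p)" "c \<in> atlas \<Longrightarrow> continuous_on (chart_dom c) (field_matrix c K)"
  using assms by (auto simp: continuous_endo_field_def)

lemma smooth_imp_continuous_endo_field:
  assumes "smooth_endo_field atlas K"
  shows "continuous_endo_field K"
  unfolding continuous_endo_field_def
proof (intro conjI allI ballI)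
  show "is_endo atlas p (K p)" for p
    using assms by (simp add: smooth_endo_field_def)
  fix c assume c: "c \<in> atlas"
  then have "smooth_on (chart_im c) (\<lambda>x. field_matrix c K (chart_inv c x))"
    using assms by (simp add: smooth_endo_field_def)
  then have "Ck_on 0 (chart_im c) (\<lambda>x. field_matrix c K (chart_inv c x))"
    by (simp only: smooth_on_def)
  then show "continuous_on (chart_dom c) (field_matrix c K)"
    using continuous_on_chart_dom[OF c, of "field_matrix c K"] by simp
qed

lemma field_matrix_lincomb:
  assumes c: "chart_around p c" and "continuous_endo_field K" "continuous_endo_field A"
  shows "field_matrix c (field_lincomb r K s A) p = r *\<^sub>R field_matrix c K p + s *\<^sub>R field_matrix c A p"
  unfolding field_lincomb_def
  by (rule endo_matrix_lincomb[OF c continuous_endo_fieldD(1)[OF assms(2)] continuous_endo_fieldD(1)[OF assms(3)]])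

lemma continuous_endo_field_lincomb:
  assumes K: "continuous_endo_field K" and A: "continuous_endo_field A"
  shows "continuous_endo_field (field_lincomb r K s A)"
  unfolding continuous_endo_field_def
proof (intro conjI allI ballI)
  show "is_endo atlas p (field_lincomb r K s A p)" for p
    unfolding field_lincomb_def
    by (rule is_endo_lincomb[OF continuous_endo_fieldD(1)[OF K] continuous_endo_fieldD(1)[OF A]])
  fix c assume c: "c \<in> atlas"
  have "continuous_on (chart_dom c) (\<lambda>p. r *\<^sub>R field_matrix c K p + s *\<^sub>R field_matrix c A p)"
    by (intro continuous_intros continuous_endo_fieldD(2)[OF K c] continuous_endo_fieldD(2)[OF A c])
  then show "continuous_on (chart_dom c) (field_matrix c (field_lincomb r K s A))"
    by (rule continuous_on_eq) (simp add: field_matrix_lincomb[OF _ K A] c)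
qed

definition anticommuting :: "('m, 'd) endo_field \<Rightarrow> ('m, 'd) endo_field \<Rightarrow> bool" where
  "anticommuting J K \<longleftrightarrow> (\<forall>p c. chart_around p c \<longrightarrow>
     field_matrix c J p ** field_matrix c K p = - (field_matrix c K p ** field_matrix c J p))"

lemma anticommutingD:
  "anticommuting J K \<Longrightarrow> chart_around p c \<Longrightarrow>
     field_matrix c J p ** field_matrix c K p = - (field_matrix c K p ** field_matrix c J p)"
  unfolding anticommuting_def by blast

lemma anticommuting_lincomb:
  assumes "continuous_endo_field K" "continuous_endo_field A" "anticommuting J K" "anticommuting J A"
  shows "anticommuting J (field_lincomb r K s A)"
  unfolding anticommuting_def
proof (intro allI impI)
  fix p c assume c: "chart_around p c"
  show "field_matrix c J p ** field_matrix c (field_lincomb r K s A) p =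
    - (field_matrix c (field_lincomb r K s A) p ** field_matrix c J p)"
    unfolding field_matrix_lincomb[OF c assms(1,2)]
    by (simp add: matrix_mult.add_left matrix_mult.add_right matrix_mult.scaleR_left matrix_mult.scaleR_right
        anticommutingD[OF assms(3) c] anticommutingD[OF assms(4) c])
qed

lemma almost_complex_structureD:
  assumes "J \<in> almost_complex_structures atlas"
  shows "continuous_endo_field J"
    and "chart_around p c \<Longrightarrow> field_matrix c J p ** field_matrix c J p = - mat 1"
proof -
  show J: "continuous_endo_field J"
    using assms by (intro smooth_imp_continuous_endo_field) (simp add: almost_complex_structures_def)
  have sq: "J p (J p v) = (\<lambda>c. - v c)" if "v \<in> tangent p" for v p
    using assms that by (simp add: almost_complex_structures_def)
  show "field_matrix c J p ** field_matrix c J p = - mat 1" if c: "chart_around p c"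
  proof -
    have "endo_matrix atlas c p (J p \<circ> J p) = - mat 1"
    proof (rule endo_matrix_eqI)
      fix x
      have "(- mat 1 :: real^'d^'d) *v x = - (mat 1 *v x)"
        using scaleR_matrix_vector_assoc[of "-1" "mat 1" x] by simp
      then show "(J p \<circ> J p) (tvec_of atlas c p x) c = - mat 1 *v x"
        using sq[OF tvec_of_in_tangent[OF c]] tvec_of_same_chart[OF c] by simp
    qed
    then show ?thesis
      using endo_matrix_compose[OF c continuous_endo_fieldD(1)[OF J] continuous_endo_fieldD(1)[OF J]] by simp
  qed
qed

lemma End_JD:
  assumes J: "J \<in> almost_complex_structures atlas" and "K \<in> End_J atlas J"
  shows "continuous_endo_field K" "anticommuting J K"
proof -
  show K: "continuous_endo_field K"
    using assms(2) by (intro smooth_imp_continuous_endo_field) (simp add: End_J_def)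
  have J': "continuous_endo_field J"
    by (rule almost_complex_structureD(1)[OF J])
  have anti: "lincomb 1 (J p (K p v)) 1 (K p (J p v)) = (\<lambda>_. 0)" if "v \<in> tangent p" for p v
    using assms(2) that by (simp add: End_J_def)
  show "anticommuting J K"
    unfolding anticommuting_def
  proof (intro allI impI)
    fix p c assume c: "chart_around p c"
    note endo = continuous_endo_fieldD(1)[OF J', of p] continuous_endo_fieldD(1)[OF K, of p]
    have "endo_matrix atlas c p (\<lambda>v. lincomb 1 ((J p \<circ> K p) v) 1 ((K p \<circ> J p) v)) = 0"
    proof (rule endo_matrix_eqI)
      show "lincomb 1 ((J p \<circ> K p) (tvec_of atlas c p x)) 1 ((K p \<circ> J p) (tvec_of atlas c p x)) c = 0 *v x" for x
        using anti[OF tvec_of_in_tangent[OF c], of x] by simp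
    qed
    then have "field_matrix c J p ** field_matrix c K p + field_matrix c K p ** field_matrix c J p = 0"
      unfolding endo_matrix_lincomb[OF c is_endo_compose[OF endo] is_endo_compose[OF endo(2,1)]]
        endo_matrix_compose[OF c endo] endo_matrix_compose[OF c endo(2,1)]
      by simp
    then show "field_matrix c J p ** field_matrix c K p = - (field_matrix c K p ** field_matrix c J p)"
      by (rule eq_neg_iff_add_eq_0[THEN iffD2])
  qed
qed

lemma endo_trace_compose3:
  assumes c: "chart_around p c" and "is_endo atlas p A" "is_endo atlas p B" "is_endo atlas p C"
  shows "endo_trace atlas p (A \<circ> B \<circ> C) =
    trace (endo_matrix atlas c p A ** endo_matrix atlas c p B ** endo_matrix atlas c p C)"
  using assms by (simp only: endo_trace_eq[OF c] endo_matrix_compose is_endo_compose)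

text \<open>The chart picked inside \<open>endo_trace\<close> may change from point to point. On the
  domain of a fixed chart the trace can nevertheless be computed in that chart, where the matrices
  are continuous.\<close>

lemma integrable_trace_compose3:
  assumes A: "continuous_endo_field A" and B: "continuous_endo_field B" and C: "continuous_endo_field C"
  shows "integrable \<mu> (\<lambda>p. endo_trace atlas p (A p \<circ> B p \<circ> C p))"
proof (intro integrable_continuous continuous_on_chartwise)
  fix c assume c: "c \<in> atlas"
  have "continuous_on (chart_dom c) (\<lambda>p. trace (field_matrix c A p ** field_matrix c B p ** field_matrix c C p))"
    by (intro bounded_linear.continuous_on[OF bounded_linear_trace] matrix_mult.continuous_on
        continuous_endo_fieldD(2)[OF A c] continuous_endo_fieldD(2)[OF B c] continuous_endo_fieldD(2)[OF C c])
  then show "continuous_on (chart_dom c) (\<lambda>p. endo_trace atlas p (A p \<circ> B p \<circ> C p))"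
  proof (rule continuous_on_eq)
    fix p assume "p \<in> chart_dom c"
    with c have "chart_around p c" by simp
    then show "trace (field_matrix c A p ** field_matrix c B p ** field_matrix c C p) =
        endo_trace atlas p (A p \<circ> B p \<circ> C p)"
      by (simp only: endo_trace_compose3 continuous_endo_fieldD(1)[OF A] continuous_endo_fieldD(1)[OF B]
          continuous_endo_fieldD(1)[OF C])
  qed
qed

lemma fundamental_form_eq:
  "fundamental_form atlas \<mu> J A B = (\<integral>p. endo_trace atlas p (A p \<circ> J p \<circ> B p) \<partial>\<mu>)"
  by (simp add: fundamental_form_def weak_metric_def acs_complex_structure_def)

text \<open>Pointwise, A J = - J A and cyclicity give tr (A J B) = - tr (J A B) = - tr (B J
  A).\<close>

lemma fundamental_form_antisym:
  assumes J: "J \<in> almost_complex_structures atlas" and A: "A \<in> End_J atlas J" and B: "B \<in> End_J atlas J"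
  shows "fundamental_form atlas \<mu> J A B = - fundamental_form atlas \<mu> J B A"
proof -
  note endo = continuous_endo_fieldD(1)[OF almost_complex_structureD(1)[OF J]]
    continuous_endo_fieldD(1)[OF End_JD(1)[OF J A]] continuous_endo_fieldD(1)[OF End_JD(1)[OF J B]]
  have "endo_trace atlas p (A p \<circ> J p \<circ> B p) = - endo_trace atlas p (B p \<circ> J p \<circ> A p)" for p
  proof -
    obtain c where c: "chart_around p c" using chart_around_exists by blast
    let ?J = "field_matrix c J p" and ?A = "field_matrix c A p" and ?B = "field_matrix c B p"
    have anti: "?A ** ?J = - (?J ** ?A)"
      by (simp add: anticommutingD[OF End_JD(2)[OF J A] c])
    have "trace (?A ** ?J ** ?B) = - trace ((?J ** ?A) ** ?B)"
      by (simp add: anti matrix_mult.minus_left trace_simps)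
    also have "trace ((?J ** ?A) ** ?B) = trace (?B ** ?J ** ?A)"
      by (subst trace_mul_sym) (simp add: matrix_mul_assoc)
    finally show ?thesis
      by (simp only: endo_trace_compose3[OF c] endo)
  qed
  then show ?thesis
    by (simp add: fundamental_form_eq)
qed

lemma fundamental_form_linear:
  assumes J: "J \<in> almost_complex_structures atlas"
    and A: "A \<in> End_J atlas J" and B: "B \<in> End_J atlas J" and C: "C \<in> End_J atlas J"
  shows "fundamental_form atlas \<mu> J (field_lincomb r A s B) C =
    r * fundamental_form atlas \<mu> J A C + s * fundamental_form atlas \<mu> J B C"
proof -
  note cont = almost_complex_structureD(1)[OF J] End_JD(1)[OF J A] End_JD(1)[OF J B] End_JD(1)[OF J C]
  have "endo_trace atlas p (field_lincomb r A s B p \<circ> J p \<circ> C p) =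
      r * endo_trace atlas p (A p \<circ> J p \<circ> C p) + s * endo_trace atlas p (B p \<circ> J p \<circ> C p)" for p
  proof -
    obtain c where c: "chart_around p c" using chart_around_exists by blast
    show ?thesis
      by (simp add: endo_trace_compose3[OF c] continuous_endo_fieldD(1)[OF cont(1)] continuous_endo_fieldD(1)[OF cont(2)]
          continuous_endo_fieldD(1)[OF cont(3)] continuous_endo_fieldD(1)[OF cont(4)]
          continuous_endo_fieldD(1)[OF continuous_endo_field_lincomb[OF cont(2,3)]]
          field_matrix_lincomb[OF c cont(2,3)] matrix_mult.add_left matrix_mult.scaleR_left trace_simps)
  qed
  then show ?thesis
    by (simp add: fundamental_form_eq integrable_trace_compose3[OF cont(2) cont(1) cont(4)]
        integrable_trace_compose3[OF cont(3) cont(1) cont(4)])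
qed

text \<open>The left-hand side mentions no chart. The formula is applied in the selected chart to
  evaluate the form, and in a fixed chart to obtain continuity on its domain.\<close>

lemma local_form_density:
  assumes J: "J \<in> almost_complex_structures atlas"
    and K: "continuous_endo_field K" "anticommuting J K"
    and B: "continuous_endo_field B" and C: "continuous_endo_field C"
    and c: "chart_around p c"
    and inv: "invertible (mat 1 - field_matrix c K p)"
  shows "endo_trace atlas p (acs_param_deriv atlas J K B p \<circ> acs_param atlas J K p \<circ> acs_param_deriv atlas J K C p)
    = form_density (field_matrix c J p) (field_matrix c K p) (field_matrix c B p) (field_matrix c C p)"
proof -
  note J' = almost_complex_structureD[OF J]
  note endo = continuous_endo_fieldD(1)[OF J'(1), of p] continuous_endo_fieldD(1)[OF K(1), of p]
  let ?J = "field_matrix c J p" and ?R = "matrix_inv (mat 1 - field_matrix c K p)"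
  have param: "is_endo atlas p (acs_param atlas J K p)"
    "field_matrix c (acs_param atlas J K) p = ?J ** (mat 1 + field_matrix c K p) ** ?R"
    by (rule endo_of_matrix[OF c], erule acs_param_eq[where J = J and K = K, OF c endo inv])+
  have deriv: "is_endo atlas p (acs_param_deriv atlas J K A p)"
    "field_matrix c (acs_param_deriv atlas J K A) p = 2 *\<^sub>R (?J ** ?R ** field_matrix c A p ** ?R)"
    if A: "continuous_endo_field A" for A
    by (rule endo_of_matrix[OF c], erule acs_param_deriv_eq[where J = J and K = K and A = A,
          OF c endo continuous_endo_fieldD(1)[OF A] inv])+
  have "endo_trace atlas p (acs_param_deriv atlas J K B p \<circ> acs_param atlas J K p \<circ> acs_param_deriv atlas J K C p)
    = trace (field_matrix c (acs_param_deriv atlas J K B) p ** field_matrix c (acs_param atlas J K) p **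
        field_matrix c (acs_param_deriv atlas J K C) p)"
    by (rule endo_trace_compose3[OF c deriv(1)[OF B] param(1) deriv(1)[OF C]])
  also have "\<dots> = form_density (field_matrix c J p) (field_matrix c K p) (field_matrix c B p) (field_matrix c C p)"
    unfolding deriv(2)[OF B] param(2) deriv(2)[OF C]
    by (rule trace_eq_form_density[OF J'(2)[OF c] anticommutingD[OF K(2) c] inv])
  finally show ?thesis .
qed

lemma invertible_chart_independent:
  assumes "continuous_endo_field K" "chart_around p c" "chart_around p d"
  shows "invertible (mat 1 - field_matrix c K p) \<longleftrightarrow> invertible (mat 1 - field_matrix d K p)"
  using bij_one_minus_iff[OF assms(2) continuous_endo_fieldD(1)[OF assms(1)]]
    bij_one_minus_iff[OF assms(3) continuous_endo_fieldD(1)[OF assms(1)]] by simp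

text \<open>The chart \<open>cp p\<close> in \<open>h\<close> varies with \<open>p\<close>. On the
  domain of any chart \<open>c\<close>, however, \<open>h\<close> coincides with the density
  computed in \<open>c\<close>, since both are the trace of the same endomorphism; so
  \<open>h\<close> is continuous.\<close>

lemma local_form_eq:
  assumes J: "J \<in> almost_complex_structures atlas"
    and K: "continuous_endo_field K" "anticommuting J K"
    and B: "continuous_endo_field B" and C: "continuous_endo_field C"
    and cp: "\<And>p. chart_around p (cp p)"
    and inv: "\<And>p. invertible (mat 1 - field_matrix (cp p) K p)"
  defines "h \<equiv> \<lambda>p. form_density (field_matrix (cp p) J p) (field_matrix (cp p) K p)
      (field_matrix (cp p) B p) (field_matrix (cp p) C p)"
  shows "local_form atlas (fundamental_form atlas \<mu>) J K B C = (\<integral>p. h p \<partial>\<mu>)" "integrable \<mu> h"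
proof -
  have h: "endo_trace atlas p (acs_param_deriv atlas J K B p \<circ> acs_param atlas J K p \<circ> acs_param_deriv atlas J K C p) = h p" for p
    unfolding h_def by (rule local_form_density[OF J K B C cp inv])
  then show "local_form atlas (fundamental_form atlas \<mu>) J K B C = (\<integral>p. h p \<partial>\<mu>)"
    by (simp add: local_form_def fundamental_form_eq)
  note J' = almost_complex_structureD[OF J]
  show "integrable \<mu> h"
  proof (intro integrable_continuous continuous_on_chartwise)
    fix c assume c: "c \<in> atlas"
    have inv_c: "invertible (mat 1 - field_matrix c K p)" if "p \<in> chart_dom c" for p
      using invertible_chart_independent[OF K(1) _ cp[of p]] inv c that by blast
    have "continuous_on (chart_dom c) (\<lambda>p. form_density (field_matrix c J p) (field_matrix c K p)
        (field_matrix c B p) (field_matrix c C p))"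
    proof (intro continuous_on_form_density continuous_endo_fieldD(2)[OF _ c] J' K B C)
      fix p assume p: "p \<in> chart_dom c"
      then have pc: "chart_around p c" using c by simp
      show "invertible (mat 1 - field_matrix c K p ** field_matrix c K p)"
        using inv_c[OF p] invertible_one_minus[OF J'(2)[OF pc] anticommutingD[OF K(2) pc]] by simp
    qed
    then show "continuous_on (chart_dom c) h"
    proof (rule continuous_on_eq)
      fix p assume p: "p \<in> chart_dom c"
      then have pc: "chart_around p c" using c by simp
      show "form_density (field_matrix c J p) (field_matrix c K p) (field_matrix c B p) (field_matrix c C p) = h p"
        using local_form_density[OF J K B C pc inv_c[OF p]] h[of p] by simp
    qed
  qed
qed

text \<open>Differentiation under the integral, with uniform bounds from a compact set of coordinate
  matrices. Integrability of \<open>h'\<close> is recorded because the three integrals of the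
  exterior derivative have to be added.\<close>

lemma local_form_has_derivative:
  assumes J: "J \<in> almost_complex_structures atlas" and K: "K \<in> acs_chart_im atlas J"
    and A: "A \<in> End_J atlas J" and B: "B \<in> End_J atlas J" and C: "C \<in> End_J atlas J"
    and cp: "tame_selection cp"
  defines "h' \<equiv> \<lambda>p. form_density_deriv (field_matrix (cp p) J p) (field_matrix (cp p) K p)
      (field_matrix (cp p) A p) (field_matrix (cp p) B p) (field_matrix (cp p) C p)"
  shows "((\<lambda>t. local_form atlas (fundamental_form atlas \<mu>) J (field_lincomb 1 K t A) B C)
      has_real_derivative (\<integral>p. h' p \<partial>\<mu>)) (at 0)" "integrable \<mu> h'"
proof -
  note J' = almost_complex_structureD[OF J]
  have "K \<in> End_J atlas J" using K by (simp add: acs_chart_im_def)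
  note K' = End_JD[OF J this] and A' = End_JD[OF J A] and B' = End_JD[OF J B] and C' = End_JD[OF J C]
  note around = tame_selection_around[OF cp]
  have inv: "invertible (mat 1 - field_matrix c K p)" if "chart_around p c" for p c
    using K bij_one_minus_iff[OF that continuous_endo_fieldD(1)[OF K'(1)]] by (simp add: acs_chart_im_def)
  \<comment> \<open>All five matrices are bundled into one map, so that a single compact set
    \<open>S\<close> captures them jointly.\<close>
  define M where "M c p = (field_matrix c J p, field_matrix c K p, field_matrix c A p, field_matrix c B p, field_matrix c C p)"
    for c p
  have "continuous_on (chart_dom c) (M c)" if "c \<in> atlas" for c
    unfolding M_def
    by (intro continuous_on_Pair continuous_endo_fieldD(2)[OF _ that] J'(1) K'(1) A'(1) B'(1) C'(1))
  then obtain S where S: "compact S" "\<And>p. M (cp p) p \<in> S" "\<And>z. z \<in> S \<Longrightarrow> \<exists>c p. chart_around p c \<and> z = M c p"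
    using tame_selection_compact[OF cp, of M] by blast
  obtain \<delta> b where \<delta>: "\<delta> > 0"
    and bound: "\<And>t MJ MK MA MB MC. \<bar>t\<bar> \<le> \<delta> \<Longrightarrow> (MJ, MK, MA, MB, MC) \<in> S \<Longrightarrow>
       invertible (mat 1 - (MK + t *\<^sub>R MA) ** (MK + t *\<^sub>R MA)) \<and>
       \<bar>form_density_deriv MJ (MK + t *\<^sub>R MA) MA MB MC\<bar> \<le> b"
  proof (rule form_density_uniform[OF S(1)])
    fix MJ MK MA MB MC assume "(MJ, MK, MA, MB, MC) \<in> S"
    then obtain c p where c: "chart_around p c" and "(MJ, MK, MA, MB, MC) = M c p"
      using S(3) by blast
    then have "MK = field_matrix c K p" by (simp add: M_def)
    then show "invertible (mat 1 - MK ** MK)"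
      using inv[OF c] invertible_one_minus[OF J'(2)[OF c] anticommutingD[OF K'(2) c]] by simp
  qed blast
  define Kt where "Kt t = field_lincomb 1 K t A" for t
  have Kt: "continuous_endo_field (Kt t)" "anticommuting J (Kt t)" for t
    unfolding Kt_def
    by (rule continuous_endo_field_lincomb[OF K'(1) A'(1)], rule anticommuting_lincomb[OF K'(1) A'(1) K'(2) A'(2)])
  have mat_Kt: "field_matrix (cp p) (Kt t) p = field_matrix (cp p) K p + t *\<^sub>R field_matrix (cp p) A p" for t p
    using field_matrix_lincomb[OF around K'(1) A'(1), of p 1 t] by (simp add: Kt_def)
  define h where "h t p = form_density (field_matrix (cp p) J p) (field_matrix (cp p) K p + t *\<^sub>R field_matrix (cp p) A p)
      (field_matrix (cp p) B p) (field_matrix (cp p) C p)" for t p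
  define h1 where "h1 t p = form_density_deriv (field_matrix (cp p) J p) (field_matrix (cp p) K p + t *\<^sub>R field_matrix (cp p) A p)
      (field_matrix (cp p) A p) (field_matrix (cp p) B p) (field_matrix (cp p) C p)" for t p
  have at_p: "invertible (mat 1 - (field_matrix (cp p) K p + t *\<^sub>R field_matrix (cp p) A p) **
        (field_matrix (cp p) K p + t *\<^sub>R field_matrix (cp p) A p)) \<and> \<bar>h1 t p\<bar> \<le> b" if "\<bar>t\<bar> \<le> \<delta>" for t p
    using bound[OF that S(2)[of p, unfolded M_def]] by (simp add: h1_def)
  have inv_t: "invertible (mat 1 - field_matrix (cp p) (Kt t) p)" if "\<bar>t\<bar> \<le> \<delta>" for t p
    using at_p[OF that, of p] invertible_one_minus[OF J'(2)[OF around] anticommutingD[OF Kt(2) around], of p t]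
    by (simp add: mat_Kt)
  have lf: "local_form atlas (fundamental_form atlas \<mu>) J (Kt t) B C = (\<integral>p. h t p \<partial>\<mu>)" "integrable \<mu> (h t)"
    if "\<bar>t\<bar> \<le> \<delta>" for t
    using local_form_eq[OF J Kt[of t] B'(1) C'(1) around inv_t[OF that]]
    by (simp_all add: mat_Kt h_def[abs_def])
  have deriv: "((\<lambda>t. \<integral>p. h t p \<partial>\<mu>) has_real_derivative (\<integral>p. h1 0 p \<partial>\<mu>)) (at 0)" and int: "integrable \<mu> (h1 0)"
  proof -
    have "((\<lambda>s. h s p) has_real_derivative h1 t p) (at t)" if "\<bar>t\<bar> \<le> \<delta>" for t p
      unfolding h_def h1_def by (rule form_density_has_derivative) (use at_p[OF that] in blast)
    note has_real_derivative_integral[where f = h and f' = h1 and b = b, OF finite_measure_volume \<delta> lf(2) this]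
    then show "((\<lambda>t. \<integral>p. h t p \<partial>\<mu>) has_real_derivative (\<integral>p. h1 0 p \<partial>\<mu>)) (at 0)" "integrable \<mu> (h1 0)"
      using at_p by blast+
  qed
  have h1_0: "h1 0 = h'"
    by (simp add: h1_def h'_def fun_eq_iff)
  show "integrable \<mu> h'" using int h1_0 by simp
  \<comment> \<open>The integral formula for the local form is known for times within
    \<open>\<delta>\<close>, where K + t A still satisfies the invertibility condition; an open
    interval around 0 is enough.\<close>
  have "((\<lambda>t. local_form atlas (fundamental_form atlas \<mu>) J (Kt t) B C) has_real_derivative (\<integral>p. h' p \<partial>\<mu>)) (at 0)"
  proof (rule has_field_derivative_transform_within_open)
    show "((\<lambda>t. \<integral>p. h t p \<partial>\<mu>) has_real_derivative (\<integral>p. h' p \<partial>\<mu>)) (at 0)"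
      using deriv unfolding h1_0 .
    show "open {- \<delta><..<\<delta>}" "0 \<in> {- \<delta><..<\<delta>}" using \<delta> by auto
    show "(\<integral>p. h t p \<partial>\<mu>) = local_form atlas (fundamental_form atlas \<mu>) J (Kt t) B C" if "t \<in> {- \<delta><..<\<delta>}" for t
      using that by (intro lf(1)[symmetric]) auto
  qed
  then show "((\<lambda>t. local_form atlas (fundamental_form atlas \<mu>) J (field_lincomb 1 K t A) B C)
      has_real_derivative (\<integral>p. h' p \<partial>\<mu>)) (at 0)"
    unfolding Kt_def .
qed

text \<open>The analytic content is differentiability in charts: it ensures that the
  \<open>deriv\<close> terms of \<open>local_ext_deriv\<close> are genuine derivatives.\<close>

lemma two_form_fundamental_form: "two_form atlas (fundamental_form atlas \<mu>)"
  unfolding two_form_def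
proof (intro conjI ballI allI)
  fix J K A B C
  assume "J \<in> almost_complex_structures atlas" "K \<in> acs_chart_im atlas J"
    "A \<in> End_J atlas J" "B \<in> End_J atlas J" "C \<in> End_J atlas J"
  moreover obtain cp where "tame_selection cp" using tame_selection_exists by blast
  ultimately show "(\<lambda>t. local_form atlas (fundamental_form atlas \<mu>) J (field_lincomb 1 K t A) B C) differentiable at 0"
    using local_form_has_derivative(1) real_differentiable_def by blast
qed (rule fundamental_form_antisym fundamental_form_linear; assumption)+

lemma closed_fundamental_form: "closed_two_form atlas (fundamental_form atlas \<mu>)"
  unfolding closed_two_form_def
proof (intro conjI ballI)
  show "two_form atlas (fundamental_form atlas \<mu>)"
    by (rule two_form_fundamental_form)
  fix J K A B C
  assume J: "J \<in> almost_complex_structures atlas" and K: "K \<in> acs_chart_im atlas J"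
    and A: "A \<in> End_J atlas J" and B: "B \<in> End_J atlas J" and C: "C \<in> End_J atlas J"
  \<comment> \<open>One selection serves all three derivatives, so their integrands use the same
    coordinates at each point and can be cancelled there.\<close>
  obtain cp where cp: "tame_selection cp" using tame_selection_exists by blast
  note J' = almost_complex_structureD[OF J]
  have "K \<in> End_J atlas J" using K by (simp add: acs_chart_im_def)
  note K' = End_JD[OF J this] and A' = End_JD[OF J A] and B' = End_JD[OF J B] and C' = End_JD[OF J C]
  define h where "h X Y Z p = form_density_deriv (field_matrix (cp p) J p) (field_matrix (cp p) K p)
      (field_matrix (cp p) X p) (field_matrix (cp p) Y p) (field_matrix (cp p) Z p)" for X Y Z p
  have h: "deriv (\<lambda>t. local_form atlas (fundamental_form atlas \<mu>) J (field_lincomb 1 K t X) Y Z) 0 = (\<integral>p. h X Y Z p \<partial>\<mu>)"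
      "integrable \<mu> (h X Y Z)"
    if "X \<in> End_J atlas J" "Y \<in> End_J atlas J" "Z \<in> End_J atlas J" for X Y Z
    using local_form_has_derivative[OF J K that cp] by (auto simp: h_def[abs_def] intro: DERIV_imp_deriv)
  have "h A B C p - h B A C p + h C A B p = 0" for p
  proof -
    note c = tame_selection_around[OF cp, of p]
    have "bij_betw (\<lambda>v. lincomb 1 v (-1) (K p v)) (tangent p) (tangent p)"
      using K by (simp add: acs_chart_im_def)
    then have "invertible (mat 1 - field_matrix (cp p) K p)"
      using bij_one_minus_iff[OF c continuous_endo_fieldD(1)[OF K'(1)]] by simp
    then have "invertible (mat 1 - field_matrix (cp p) K p ** field_matrix (cp p) K p)"
      using invertible_one_minus[OF J'(2)[OF c] anticommutingD[OF K'(2) c]] by simp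
    then show ?thesis
      unfolding h_def
      by (rule form_density_deriv_cyclic[OF J'(2)[OF c] anticommutingD[OF K'(2) c]
            anticommutingD[OF A'(2) c] anticommutingD[OF B'(2) c] anticommutingD[OF C'(2) c]])
  qed
  then have "(\<integral>p. h A B C p - h B A C p + h C A B p \<partial>\<mu>) = 0"
    by simp
  then show "local_ext_deriv atlas (fundamental_form atlas \<mu>) J K A B C = 0"
    using h A B C by (simp add: local_ext_deriv_def)
qed

end

theorem theorem2:
  fixes atlas :: "('m::{t2_space, second_countable_topology}, 'd::finite) chart set"
    and g\<^sub>0 :: "'m \<Rightarrow> ('m, 'd) tvec \<Rightarrow> ('m, 'd) tvec \<Rightarrow> real"
    and \<mu> :: "'m measure"
    and n :: nat
  assumes "closed_oriented_manifold atlas"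
    and "CARD('d) = 2 * n"
    and "riemannian_metric atlas g\<^sub>0"
    and "is_riemannian_volume atlas g\<^sub>0 \<mu>"
  shows "(\<forall>J\<in>almost_complex_structures atlas. \<forall>A\<in>End_J atlas J. \<forall>B\<in>End_J atlas J.
            fundamental_form atlas \<mu> J A B = (\<integral>p. endo_trace atlas p (A p \<circ> J p \<circ> B p) \<partial>\<mu>)) \<and>
         closed_two_form atlas (fundamental_form atlas \<mu>)"
proof -
  interpret closed_riemannian_manifold atlas g\<^sub>0 \<mu>
    using assms by unfold_locales
  show ?thesis
    using fundamental_form_eq closed_fundamental_form by blast
qed

end
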